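(* Let $G$ be a finitely generated recursively presented group. The class of effectively closed subshifts on $G$ is closed under factors: if $X\subset A_X^G$ is an effectively closed subshift, $Y\subset A_Y^G$ is a subshift ($A_X,A_Y$ finite alphabets) and there is a continuous, shift-commuting, surjective map $\phi:X\to Y$, then $Y$ is effectively closed.
   Context: Let $S\subset G$ be a finite generating set closed under inverses and containing $1_G$; words in $S^*$ represent elements of $G$. $G$ is recursively presented if it has a presentation $\langle S\mid R\rangle$ with $S$ finite and $R\subset S^*$ recursively enumerable. For a finite alphabet $A$, $A^G$ has the product topology and left shift action $(\sigma_g x)_h=x_{g^{-1}h}$; a subshift is a closed shift-invariant subset. Put $[a]_g=\{x\in A^G:x_g=a\}$. A pattern coding over $A$ is a finite set $c$ of pairs $(w,a)$ with $w\in S^*$, $a\in A$. For a set $\mathcal C$ of pattern codings, $X_{\mathcal C}=\bigcap_{g\in G,\,c\in\mathcal C}\big(A^G\setminus\bigcap_{(w,a)\in c}[a]_{gw}\big)$. $X\subset A^G$ is effectively closed if $X=X_{\mathcal C}$ for some recursively enumerable set $\mathcal C$ of pattern codings over $A$. *)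

theory Defs
  imports "HOL-Analysis.Analysis" "HOL-Algebra.Generated_Groups" "HOL-Library.Nat_Bijection"
begin

text \<open>Partial recursive functions. \<open>computes f xs y\<close> means that \<open>f\<close> is defined on the
  argument tuple \<open>xs\<close> with value \<open>y\<close>. Primitive recursion acts on the first argument, with
  the step function applied to counter, previous value and parameters. Arities are not tracked:
  a term applied to too few arguments is undefined.\<close>

datatype recf =
  Zero | Succ | Proj nat | Comp recf "recf list" | PrimRec recf recf | Mu recf

inductive computes :: "recf \<Rightarrow> nat list \<Rightarrow> nat \<Rightarrow> bool" where
  zero: "computes Zero xs 0"
| succ: "computes Succ (x # xs) (Suc x)"
| proj: "i < length xs \<Longrightarrow> computes (Proj i) xs (xs ! i)"
| comp: "list_all2 (\<lambda>g y. computes g xs y) gs ys \<Longrightarrow> computes f ys z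
    \<Longrightarrow> computes (Comp f gs) xs z"
| prim_0: "computes f xs y \<Longrightarrow> computes (PrimRec f g) (0 # xs) y"
| prim_Suc: "computes (PrimRec f g) (n # xs) y \<Longrightarrow> computes g (n # y # xs) z
    \<Longrightarrow> computes (PrimRec f g) (Suc n # xs) z"
| mu: "computes f (n # xs) 0 \<Longrightarrow> \<forall>m<n. \<exists>y. computes f (m # xs) (Suc y)
    \<Longrightarrow> computes (Mu f) xs n"

lemma computes_deterministic:
  "computes f xs y \<Longrightarrow> computes f xs z \<Longrightarrow> z = y"
proof (induction arbitrary: z rule: computes.induct)
  case (comp xs gs ys f v)
  from comp.prems obtain ys' where
    ys': "list_all2 (\<lambda>g y. computes g xs y) gs ys'" and f: "computes f ys' z"
    by cases auto
  have "ys' = ys"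
    using comp.IH(1) ys' by (auto simp: list_all2_conv_all_nth intro!: nth_equalityI)
  with f comp.IH(2) show ?case by blast
next
  case (mu f n xs)
  from mu.prems obtain
    "computes f (z # xs) 0" "\<forall>m<z. \<exists>y. computes f (m # xs) (Suc y)"
    by cases auto
  with mu.IH show ?case by (metis nat.distinct(1) nat_neq_iff)
next
  case (prim_0 f xs y g)
  from prim_0.prems show ?case by cases (use prim_0.IH in auto)
next
  case (prim_Suc f g n xs y v)
  from prim_Suc.prems show ?case by cases (use prim_Suc.IH in auto)
qed (auto elim: computes.cases)

definition rec_enumerable :: "nat set \<Rightarrow> bool" where
  "rec_enumerable N \<longleftrightarrow> (\<exists>f. \<forall>n. n \<in> N \<longleftrightarrow> (\<exists>y. computes f [n] y))"

text \<open>Words over a finite alphabet \<open>S\<close> and pattern codings over finite \<open>S\<close>, \<open>A\<close> are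
  transported to natural numbers by numbering the letters injectively and then using the
  standard computable encodings of lists, pairs and finite sets. For finite alphabets, two
  numberings differ by a finite table, so the notions below do not depend on the choice.\<close>

definition rec_enumerable_words :: "'a set \<Rightarrow> 'a list set \<Rightarrow> bool" where
  "rec_enumerable_words S L \<longleftrightarrow>
     (\<exists>e. inj_on e S \<and> rec_enumerable ((\<lambda>w. list_encode (map e w)) ` L))"

type_synonym ('a, 'b) pattern_coding = "('a list \<times> 'b) set"

definition pattern_codings :: "'a set \<Rightarrow> 'b set \<Rightarrow> ('a, 'b) pattern_coding set" where
  "pattern_codings S A = {c. finite c \<and> c \<subseteq> lists S \<times> A}"

definition encode_coding ::
  "('a \<Rightarrow> nat) \<Rightarrow> ('b \<Rightarrow> nat) \<Rightarrow> ('a, 'b) pattern_coding \<Rightarrow> nat" where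
  "encode_coding e d c =
     set_encode ((\<lambda>(w, a). prod_encode (list_encode (map e w), d a)) ` c)"

definition rec_enumerable_codings ::
  "'a set \<Rightarrow> 'b set \<Rightarrow> ('a, 'b) pattern_coding set \<Rightarrow> bool" where
  "rec_enumerable_codings S A C \<longleftrightarrow>
     (\<exists>e d. inj_on e S \<and> inj_on d A \<and> rec_enumerable (encode_coding e d ` C))"

definition symmetric_generating_set :: "('a, 'm) monoid_scheme \<Rightarrow> 'a set \<Rightarrow> bool" where
  "symmetric_generating_set G S \<longleftrightarrow>
     finite S \<and> S \<subseteq> carrier G \<and> \<one>\<^bsub>G\<^esub> \<in> S \<and> (\<forall>s\<in>S. inv\<^bsub>G\<^esub> s \<in> S) \<and> generate G S = carrier G"

definition word_value :: "('a, 'm) monoid_scheme \<Rightarrow> 'a list \<Rightarrow> 'a" where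
  "word_value G w = foldr (\<otimes>\<^bsub>G\<^esub>) w \<one>\<^bsub>G\<^esub>"

text \<open>Equality of words in the group presented by \<open>\<langle>S | R\<rangle>\<close>, where \<open>S\<close> is a symmetric
  subset of \<open>G\<close> and the letter \<open>inv s\<close> serves as the formal inverse of the letter \<open>s\<close>:
  the congruence on \<open>S*\<close> generated by free cancellation and by deleting relators. The letter
  \<open>1\<close> is not identified with the empty word unless this follows from \<open>R\<close>.\<close>

inductive presented_eq ::
  "('a, 'm) monoid_scheme \<Rightarrow> 'a set \<Rightarrow> 'a list set \<Rightarrow> 'a list \<Rightarrow> 'a list \<Rightarrow> bool"
  for G S R where
  refl: "u \<in> lists S \<Longrightarrow> presented_eq G S R u u"
| sym: "presented_eq G S R u v \<Longrightarrow> presented_eq G S R v u"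
| trans: "presented_eq G S R u v \<Longrightarrow> presented_eq G S R v w \<Longrightarrow> presented_eq G S R u w"
| cancel: "u \<in> lists S \<Longrightarrow> v \<in> lists S \<Longrightarrow> s \<in> S
    \<Longrightarrow> presented_eq G S R (u @ [s, inv\<^bsub>G\<^esub> s] @ v) (u @ v)"
| relator: "u \<in> lists S \<Longrightarrow> v \<in> lists S \<Longrightarrow> r \<in> R
    \<Longrightarrow> presented_eq G S R (u @ r @ v) (u @ v)"

text \<open>\<open>G = \<langle>S | R\<rangle>\<close>: evaluation of words induces an isomorphism from the presented group
  onto \<open>G\<close> (it is onto because \<open>S\<close> generates \<open>G\<close>).\<close>

definition presentation :: "('a, 'm) monoid_scheme \<Rightarrow> 'a set \<Rightarrow> 'a list set \<Rightarrow> bool" where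
  "presentation G S R \<longleftrightarrow>
     symmetric_generating_set G S \<and> R \<subseteq> lists S \<and>
     (\<forall>u\<in>lists S. \<forall>v\<in>lists S. word_value G u = word_value G v \<longleftrightarrow> presented_eq G S R u v)"

definition recursively_presented :: "('a, 'm) monoid_scheme \<Rightarrow> bool" where
  "recursively_presented G \<longleftrightarrow> (\<exists>S R. presentation G S R \<and> rec_enumerable_words S R)"

definition configs :: "('a, 'm) monoid_scheme \<Rightarrow> 'b set \<Rightarrow> ('a \<Rightarrow> 'b) set" where
  "configs G A = carrier G \<rightarrow>\<^sub>E A"

definition config_topology :: "('a, 'm) monoid_scheme \<Rightarrow> 'b set \<Rightarrow> ('a \<Rightarrow> 'b) topology" where
  "config_topology G A = product_topology (\<lambda>_. discrete_topology A) (carrier G)"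

definition shift :: "('a, 'm) monoid_scheme \<Rightarrow> 'a \<Rightarrow> ('a \<Rightarrow> 'b) \<Rightarrow> 'a \<Rightarrow> 'b" where
  "shift G g x = (\<lambda>h\<in>carrier G. x (inv\<^bsub>G\<^esub> g \<otimes>\<^bsub>G\<^esub> h))"

definition subshift :: "('a, 'm) monoid_scheme \<Rightarrow> 'b set \<Rightarrow> ('a \<Rightarrow> 'b) set \<Rightarrow> bool" where
  "subshift G A X \<longleftrightarrow>
     closedin (config_topology G A) X \<and> (\<forall>g\<in>carrier G. \<forall>x\<in>X. shift G g x \<in> X)"

definition cylinder ::
  "('a, 'm) monoid_scheme \<Rightarrow> 'b set \<Rightarrow> 'b \<Rightarrow> 'a \<Rightarrow> ('a \<Rightarrow> 'b) set" where
  "cylinder G A a g = {x \<in> configs G A. x g = a}"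

text \<open>The outer intersection with \<open>configs G A\<close> only matters for empty \<open>C\<close>. The empty
  coding imposes no constraint on a configuration, so forbidding it yields the empty set.\<close>

definition avoiding ::
  "('a, 'm) monoid_scheme \<Rightarrow> 'b set \<Rightarrow> ('a, 'b) pattern_coding set \<Rightarrow> ('a \<Rightarrow> 'b) set" where
  "avoiding G A C = configs G A \<inter>
     (\<Inter>g\<in>carrier G. \<Inter>c\<in>C.
        configs G A - (\<Inter>(w, a)\<in>c. cylinder G A a (g \<otimes>\<^bsub>G\<^esub> word_value G w)))"

definition effectively_closed ::
  "('a, 'm) monoid_scheme \<Rightarrow> 'a set \<Rightarrow> 'b set \<Rightarrow> ('a \<Rightarrow> 'b) set \<Rightarrow> bool" where
  "effectively_closed G S A X \<longleftrightarrow>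
     (\<exists>C. C \<subseteq> pattern_codings S A \<and> rec_enumerable_codings S A C \<and> X = avoiding G A C)"

definition factor_map ::
  "('a, 'm) monoid_scheme \<Rightarrow> 'b set \<Rightarrow> ('a \<Rightarrow> 'b) set \<Rightarrow> 'c set \<Rightarrow> ('a \<Rightarrow> 'c) set
     \<Rightarrow> (('a \<Rightarrow> 'b) \<Rightarrow> ('a \<Rightarrow> 'c)) \<Rightarrow> bool" where
  "factor_map G A X B Y \<phi> \<longleftrightarrow>
     continuous_map (subtopology (config_topology G A) X)
       (subtopology (config_topology G B) Y) \<phi> \<and>
     (\<forall>g\<in>carrier G. \<forall>x\<in>X. \<phi> (shift G g x) = shift G g (\<phi> x)) \<and>
     \<phi> ` X = Y"

end

theory Submission
  imports Defs
begin

text \<open>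
  Let \<open>X\<close> be effectively closed, defined by forbidding the codings in \<open>C\<close>, and let
  \<open>\<phi> : X \<rightarrow> Y\<close> be the factor map. A subshift is always defined by forbidding every coding that none
  of its configurations matches (\<open>avoiding_forbidden_codings\<close>), so it suffices that the set of the
  codings \<open>p\<close> matched by no element of \<open>Y\<close> is recursively enumerable. Now \<open>p\<close> is matched by no
  element of \<open>Y\<close> iff no \<open>x \<in> X\<close> has an image that matches \<open>p\<close>. By compactness of \<open>X\<close>, the map
  \<open>\<phi>\<close> is a sliding block code: the symbol of \<open>\<phi> x\<close> at the identity depends only on \<open>x\<close> restricted
  to a finite window \<open>F\<close> (\<open>factor_map_finite_window\<close>). The existence of \<open>x\<close> is thereby a
  propositional satisfiability problem in the atoms ``\<open>x\<close> has the letter \<open>a\<close> at the place named by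
  these words'', with clauses of four kinds, each of which can be enumerated: every place has a
  letter; places identified by the relators of the presentation have the same letter; no coding of
  \<open>C\<close> occurs; the local rule of \<open>\<phi>\<close> yields the symbols prescribed by \<open>p\<close>.

  Places are named by words, not by group elements, and only the elementary identifications (insert
  a relator; rewrite a letter of \<open>S\<close> into generators of the presentation) are clauses. Equality of
  words in the group is a consequence of finitely many of them, so the word problem itself never has
  to be enumerated, and \<open>S\<close> may differ from the generators of the recursive presentation.

  By Koenig's lemma, an infinite set of such clauses is unsatisfiable iff, for some \<open>N\<close>, every set of
  atoms with codes below \<open>N\<close> is refuted by a clause (\<open>no_preimage_iff_refuted\<close>; soundness is
  \<open>not_refuted_of_preimage\<close>, and \<open>preimage_of_not_refuted\<close> builds a configuration from a model).
  Sets of atoms below \<open>N\<close> are coded by the numbers \<open>t < 2 ^ N\<close>, so the condition has the form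
  \<open>\<exists>N. \<forall>t<2 ^ N. \<dots>\<close> with a \<open>\<Sigma>\<^sub>1\<close> matrix.

  The computability part therefore consists of closing the \<open>\<Sigma>\<^sub>1\<close> predicates (projections of
  decidable ones) under conjunction, disjunction, existential and bounded universal quantification,
  and of identifying them with the recursively enumerable sets. Only the latter needs codes of
  computation histories: the graph of a partial recursive function is \<open>\<Sigma>\<^sub>1\<close> (\<open>sigma1_computes\<close>).
\<close>

section \<open>Total recursive functions and decidable predicates\<close>

text \<open>Functions of several variables are functions of a list of fixed length \<open>k\<close>. A variable is the
  head of an iterated tail, and a binder (recursion, minimisation, quantification) pushes its value in
  front of the list. Thus the closure rules below apply by higher-order unification to an expression
  with named bound variables.\<close>

definition total_rec :: "nat \<Rightarrow> (nat list \<Rightarrow> nat) \<Rightarrow> bool" where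
  "total_rec k F \<longleftrightarrow> (\<exists>f. \<forall>xs. length xs = k \<longrightarrow> computes f xs (F xs))"

lemma total_rec_cong:
  assumes "total_rec k F" and "\<And>xs. length xs = k \<Longrightarrow> F xs = F' xs"
  shows "total_rec k F'"
  using assms unfolding total_rec_def by metis

lemma total_rec_compose:
  assumes "total_rec (length Gs) F" and "\<And>G. G \<in> set Gs \<Longrightarrow> total_rec k G"
  shows "total_rec k (\<lambda>xs. F (map (\<lambda>G. G xs) Gs))"
proof -
  obtain f where f: "\<And>xs. length xs = length Gs \<Longrightarrow> computes f xs (F xs)"
    using assms(1) unfolding total_rec_def by blast
  obtain g where g: "\<And>G xs. G \<in> set Gs \<Longrightarrow> length xs = k \<Longrightarrow> computes (g G) xs (G xs)"
    using assms(2) unfolding total_rec_def by metis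
  have "computes (Comp f (map g Gs)) xs (F (map (\<lambda>G. G xs) Gs))" if "length xs = k" for xs
    by (rule computes.comp[of xs _ "map (\<lambda>G. G xs) Gs"])
      (auto simp: list_all2_conv_all_nth intro!: g f that)
  then show ?thesis
    unfolding total_rec_def by blast
qed

lemma total_rec_nth: "n < k \<Longrightarrow> total_rec k (\<lambda>xs. xs ! n)"
  unfolding total_rec_def using computes.proj by metis

lemma total_rec_var: "n < k \<Longrightarrow> total_rec k (\<lambda>xs. hd (drop n xs))"
  by (rule total_rec_cong[OF total_rec_nth[of n]]) (auto simp: hd_drop_conv_nth)

text \<open>Weakening: a function of the outer variables may be used under a binder.\<close>

lemma total_rec_tl: "total_rec k F \<Longrightarrow> total_rec (Suc k) (\<lambda>xs. F (tl xs))"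
proof (rule total_rec_cong)
  assume "total_rec k F"
  then show "total_rec (Suc k) (\<lambda>xs. F (map (\<lambda>G. G xs) (map (\<lambda>n xs. xs ! Suc n) [0..<k])))"
    by (intro total_rec_compose) (auto intro: total_rec_nth)
next
  fix xs :: "nat list"
  assume "length xs = Suc k"
  then show "F (map (\<lambda>G. G xs) (map (\<lambda>n xs. xs ! Suc n) [0..<k])) = F (tl xs)"
    by (intro arg_cong[of _ _ F] nth_equalityI) (auto simp: nth_tl)
qed

lemma total_rec_compose1:
  assumes "total_rec 1 (\<lambda>xs. f (hd xs))" "total_rec k F"
  shows "total_rec k (\<lambda>xs. f (F xs))"
  using total_rec_compose[of "[F]" "\<lambda>xs. f (hd xs)"] assms by simp

lemma total_rec_Suc:
  assumes "total_rec k F"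
  shows "total_rec k (\<lambda>xs. Suc (F xs))"
proof (rule total_rec_compose1[OF _ assms])
  have "computes Succ xs (Suc (hd xs))" if "length xs = 1" for xs
    using that computes.succ[of "hd xs" "tl xs"] by (cases xs) auto
  then show "total_rec 1 (\<lambda>xs. Suc (hd xs))"
    unfolding total_rec_def by blast
qed

lemma total_rec_const: "total_rec k (\<lambda>xs. c)"
proof (induction c)
  case 0
  then show ?case unfolding total_rec_def using computes.zero by blast
qed (rule total_rec_Suc)

lemma total_rec_rec_nat:
  assumes "total_rec k A" and "total_rec (Suc (Suc k)) (\<lambda>ys. B (hd ys) (hd (tl ys)) (tl (tl ys)))"
    and "total_rec k N"
  shows "total_rec k (\<lambda>xs. rec_nat (A xs) (\<lambda>n y. B n y xs) (N xs))"
proof -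
  obtain a where a: "\<And>xs. length xs = k \<Longrightarrow> computes a xs (A xs)"
    using assms(1) unfolding total_rec_def by blast
  obtain b where b: "\<And>xs. length xs = Suc (Suc k) \<Longrightarrow>
      computes b xs (B (hd xs) (hd (tl xs)) (tl (tl xs)))"
    using assms(2) unfolding total_rec_def by blast
  have "computes (PrimRec a b) (n # xs) (rec_nat (A xs) (\<lambda>n y. B n y xs) n)"
    if "length xs = k" for n xs
  proof (induction n)
    case (Suc n)
    then show ?case
      using b[of "n # rec_nat (A xs) (\<lambda>n y. B n y xs) n # xs"] that
      by (auto intro: computes.prim_Suc)
  qed (auto intro: computes.prim_0 a that)
  then have "\<And>xs. length xs = Suc k \<Longrightarrow>
      computes (PrimRec a b) xs (rec_nat (A (tl xs)) (\<lambda>n y. B n y (tl xs)) (hd xs))"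
    by (metis length_Suc_conv list.sel(1,3))
  then have *: "total_rec (Suc k) (\<lambda>xs. rec_nat (A (tl xs)) (\<lambda>n y. B n y (tl xs)) (hd xs))"
    unfolding total_rec_def by blast
  have "total_rec k (\<lambda>xs. (\<lambda>xs. rec_nat (A (tl xs)) (\<lambda>n y. B n y (tl xs)) (hd xs))
          (map (\<lambda>G. G xs) (N # map (\<lambda>n xs. xs ! n) [0..<k])))"
    using * assms(3) by (intro total_rec_compose) (auto intro: total_rec_nth)
  then show ?thesis
  proof (rule total_rec_cong)
    fix xs :: "nat list"
    assume "length xs = k"
    then have "map (\<lambda>G. G xs) (map (\<lambda>n xs. xs ! n) [0..<k]) = xs"
      by (intro nth_equalityI) auto
    then show "rec_nat (A (tl (map (\<lambda>G. G xs) (N # map (\<lambda>n xs. xs ! n) [0..<k]))))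
        (\<lambda>n y. B n y (tl (map (\<lambda>G. G xs) (N # map (\<lambda>n xs. xs ! n) [0..<k]))))
        (hd (map (\<lambda>G. G xs) (N # map (\<lambda>n xs. xs ! n) [0..<k])))
      = rec_nat (A xs) (\<lambda>n y. B n y xs) (N xs)"
      by simp
  qed
qed

lemmas total_rec_vars =
  total_rec_var[of 0, simplified]
  total_rec_var[of "Suc 0", unfolded drop_Suc drop_0]
  total_rec_var[of "Suc (Suc 0)", unfolded drop_Suc drop_0]
  total_rec_var[of "Suc (Suc (Suc 0))", unfolded drop_Suc drop_0]
  total_rec_var[of "Suc (Suc (Suc (Suc 0)))", unfolded drop_Suc drop_0]
text \<open>Truth is coded by 0, the value that the minimisation operator searches for.\<close>

definition decidable :: "nat \<Rightarrow> (nat list \<Rightarrow> bool) \<Rightarrow> bool" where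
  "decidable k P \<longleftrightarrow> total_rec k (\<lambda>xs. if P xs then 0 else 1)"

text \<open>Case distinction is a primitive recursion on the truth value whose step ignores the previous
  value; the connectives are special cases of it.\<close>

lemma total_rec_if:
  assumes "decidable k P" "total_rec k F" "total_rec k G"
  shows "total_rec k (\<lambda>xs. if P xs then F xs else G xs)"
proof (rule total_rec_cong)
  show "total_rec k (\<lambda>xs. rec_nat (F xs) (\<lambda>_ _. G xs) (if P xs then 0 else 1))"
    using assms unfolding decidable_def
    by (intro total_rec_rec_nat) (auto intro: total_rec_tl)
qed auto

lemma decidable_not: "decidable k P \<Longrightarrow> decidable k (\<lambda>xs. \<not> P xs)"
  unfolding decidable_def[of k "\<lambda>xs. \<not> P xs"] if_not_P
  by (rule total_rec_cong[OF total_rec_if[of k P "\<lambda>_. 1" "\<lambda>_. 0"]]) (auto intro: total_rec_const)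

lemma decidable_conj:
  assumes "decidable k P" "decidable k Q"
  shows "decidable k (\<lambda>xs. P xs \<and> Q xs)"
proof -
  have "total_rec k (\<lambda>xs. if P xs then if Q xs then 0 else 1 else 1)"
    by (intro total_rec_if total_rec_const assms)
  then show ?thesis
    unfolding decidable_def by (rule total_rec_cong) auto
qed

lemma decidable_disj:
  assumes "decidable k P" "decidable k Q"
  shows "decidable k (\<lambda>xs. P xs \<or> Q xs)"
  using decidable_not[OF decidable_conj[OF assms[THEN decidable_not]]] by simp

lemma decidable_tl: "decidable k P \<Longrightarrow> decidable (Suc k) (\<lambda>xs. P (tl xs))"
  unfolding decidable_def by (rule total_rec_tl)

lemma total_rec_pred: "total_rec k F \<Longrightarrow> total_rec k (\<lambda>xs. F xs - 1)"
proof (rule total_rec_cong)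
  assume "total_rec k F"
  then show "total_rec k (\<lambda>xs. rec_nat 0 (\<lambda>n _. n) (F xs))"
    by (intro total_rec_rec_nat total_rec_const total_rec_vars) simp_all
next
  show "rec_nat 0 (\<lambda>n _. n) (F xs) = F xs - 1" for xs
    by (cases "F xs") simp_all
qed

lemma total_rec_diff:
  assumes "total_rec k F" "total_rec k G"
  shows "total_rec k (\<lambda>xs. F xs - G xs)"
proof (rule total_rec_cong)
  show "total_rec k (\<lambda>xs. rec_nat (F xs) (\<lambda>_ y. y - 1) (G xs))"
    using assms by (intro total_rec_rec_nat total_rec_pred total_rec_vars) simp_all
next
  have "rec_nat m (\<lambda>_ y. y - 1) n = m - n" for m n :: nat
    by (induction n) simp_all
  then show "rec_nat (F xs) (\<lambda>_ y. y - 1) (G xs) = F xs - G xs" for xs .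
qed

lemma decidable_le:
  assumes "total_rec k F" "total_rec k G"
  shows "decidable k (\<lambda>xs. F xs \<le> G xs)"
proof -
  have "total_rec k (\<lambda>xs. 1 - (1 - (F xs - G xs)))"
    by (intro total_rec_diff total_rec_const assms)
  then show ?thesis
    unfolding decidable_def by (rule total_rec_cong) auto
qed

lemma decidable_less:
  assumes "total_rec k F" "total_rec k G"
  shows "decidable k (\<lambda>xs. F xs < G xs)"
  using decidable_not[OF decidable_le[OF assms(2,1)]] by (simp add: not_le)

lemma decidable_eq:
  assumes "total_rec k F" "total_rec k G"
  shows "decidable k (\<lambda>xs. F xs = G xs)"
  using decidable_conj[OF decidable_le[OF assms] decidable_le[OF assms(2,1)]]
  by (simp add: eq_iff)

lemma decidable_const: "decidable k (\<lambda>xs. b)"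
  unfolding decidable_def by (rule total_rec_const)

lemma decidable_cong:
  assumes "decidable k P" and "\<And>xs. length xs = k \<Longrightarrow> P xs \<longleftrightarrow> P' xs"
  shows "decidable k P'"
  using assms unfolding decidable_def by (auto elim!: total_rec_cong)

lemma total_rec_Least:
  assumes "decidable (Suc k) (\<lambda>ys. P (hd ys) (tl ys))"
    and "\<And>xs. length xs = k \<Longrightarrow> \<exists>n. P n xs"
  shows "total_rec k (\<lambda>xs. LEAST n. P n xs)"
proof -
  obtain f where f: "\<And>ys. length ys = Suc k \<Longrightarrow> computes f ys (if P (hd ys) (tl ys) then 0 else 1)"
    using assms(1) unfolding decidable_def total_rec_def by blast
  have "computes (Mu f) xs (LEAST n. P n xs)" if xs: "length xs = k" for xs
  proof (rule computes.mu)
    let ?n = "LEAST n. P n xs"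
    have "P ?n xs"
      using assms(2)[OF xs] by (rule LeastI_ex)
    then show "computes f (?n # xs) 0"
      using f[of "?n # xs"] xs by simp
    show "\<forall>m<?n. \<exists>y. computes f (m # xs) (Suc y)"
    proof (intro allI impI)
      fix m
      assume "m < ?n"
      then have "\<not> P m xs"
        by (rule not_less_Least)
      then show "\<exists>y. computes f (m # xs) (Suc y)"
        using f[of "m # xs"] xs by auto
    qed
  qed
  then show ?thesis
    unfolding total_rec_def by blast
qed

text \<open>The least \<open>i\<close> that is either the bound or a counterexample always exists, and it is the bound iff
  there is no counterexample.\<close>

lemma decidable_all_less:
  assumes "decidable (Suc k) (\<lambda>ys. P (hd ys) (tl ys))" and "total_rec k N"
  shows "decidable k (\<lambda>xs. \<forall>i<N xs. P i xs)"
proof (rule decidable_cong)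
  have "decidable (Suc k) (\<lambda>ys. hd ys = N (tl ys) \<or> \<not> P (hd ys) (tl ys))"
    by (intro decidable_disj decidable_not decidable_eq total_rec_vars total_rec_tl assms) simp
  then have "total_rec k (\<lambda>xs. LEAST i. i = N xs \<or> \<not> P i xs)"
    by (rule total_rec_Least) blast
  then show "decidable k (\<lambda>xs. N xs \<le> (LEAST i. i = N xs \<or> \<not> P i xs))"
    using assms by (intro decidable_le)
next
  fix xs :: "nat list"
  define l where "l = (LEAST i. i = N xs \<or> \<not> P i xs)"
  have l: "l = N xs \<or> \<not> P l xs"
    unfolding l_def by (rule LeastI[of _ "N xs"]) simp
  have "l \<le> i" if "\<not> P i xs" for i
    unfolding l_def using that by (intro Least_le) simp
  with l have "N xs \<le> l \<longleftrightarrow> (\<forall>i<N xs. P i xs)"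
    by (meson leD leI order_refl less_le_trans)
  then show "N xs \<le> (LEAST i. i = N xs \<or> \<not> P i xs) \<longleftrightarrow> (\<forall>i<N xs. P i xs)"
    unfolding l_def .
qed

lemma decidable_ex_less:
  assumes "decidable (Suc k) (\<lambda>ys. P (hd ys) (tl ys))" and "total_rec k N"
  shows "decidable k (\<lambda>xs. \<exists>i<N xs. P i xs)"
proof (rule decidable_cong)
  have "decidable k (\<lambda>xs. \<forall>i<N xs. \<not> P i xs)"
    by (rule decidable_all_less) (rule decidable_not assms)+
  then show "decidable k (\<lambda>xs. \<not> (\<forall>i<N xs. \<not> P i xs))"
    by (rule decidable_not)
qed simp

lemma decidable_finite_Bex:
  assumes "finite B" and "\<And>b. b \<in> B \<Longrightarrow> decidable k (P b)"
  shows "decidable k (\<lambda>xs. \<exists>b\<in>B. P b xs)"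
  using assms by (induction B rule: finite_induct) (simp_all add: decidable_const decidable_disj)

lemma decidable_mem_finite:
  assumes "finite B" and "total_rec k F"
  shows "decidable k (\<lambda>xs. F xs \<in> B)"
proof (rule decidable_cong)
  show "decidable k (\<lambda>xs. \<exists>b\<in>B. F xs = b)"
    by (intro decidable_finite_Bex decidable_eq total_rec_const assms)
qed auto

lemma total_rec_add:
  assumes "total_rec k F" "total_rec k G"
  shows "total_rec k (\<lambda>xs. F xs + G xs)"
proof (rule total_rec_cong)
  show "total_rec k (\<lambda>xs. rec_nat (F xs) (\<lambda>_ y. Suc y) (G xs))"
    using assms by (intro total_rec_rec_nat total_rec_Suc total_rec_vars) simp_all
next
  have "rec_nat m (\<lambda>_ y. Suc y) n = m + n" for m n :: nat
    by (induction n) simp_all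
  then show "rec_nat (F xs) (\<lambda>_ y. Suc y) (G xs) = F xs + G xs" for xs .
qed

lemma total_rec_mult:
  assumes "total_rec k F" "total_rec k G"
  shows "total_rec k (\<lambda>xs. F xs * G xs)"
proof (rule total_rec_cong)
  have "total_rec (Suc (Suc k)) (\<lambda>ys. hd (tl ys) + F (tl (tl ys)))"
    using assms by (intro total_rec_add total_rec_tl total_rec_vars) simp_all
  then show "total_rec k (\<lambda>xs. rec_nat 0 (\<lambda>_ y. y + F xs) (G xs))"
    using assms by (intro total_rec_rec_nat total_rec_const)
next
  have "rec_nat 0 (\<lambda>_ y. y + m) n = m * n" for m n :: nat
    by (induction n) simp_all
  then show "rec_nat 0 (\<lambda>_ y. y + F xs) (G xs) = F xs * G xs" for xs .
qed

lemma total_rec_power_2: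
  assumes "total_rec k F"
  shows "total_rec k (\<lambda>xs. 2 ^ F xs)"
proof (rule total_rec_cong)
  show "total_rec k (\<lambda>xs. rec_nat 1 (\<lambda>_ y. y + y) (F xs))"
    using assms by (intro total_rec_rec_nat total_rec_const total_rec_add total_rec_vars) simp_all
next
  have "rec_nat 1 (\<lambda>_ y. y + y) n = (2::nat) ^ n" for n
    by (induction n) simp_all
  then show "rec_nat 1 (\<lambda>_ y. y + y) (F xs) = (2::nat) ^ F xs" for xs .
qed

lemma total_rec_prod_encode:
  assumes "total_rec k F" "total_rec k G"
  shows "total_rec k (\<lambda>xs. prod_encode (F xs, G xs))"
proof (rule total_rec_cong)
  \<comment> \<open>the recursion computes the triangular numbers of Cantor's pairing function\<close>
  show "total_rec k (\<lambda>xs. rec_nat 0 (\<lambda>n y. y + Suc n) (F xs + G xs) + F xs)"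
    using assms
    by (intro total_rec_rec_nat total_rec_add total_rec_Suc total_rec_const total_rec_vars) simp_all
next
  have "rec_nat 0 (\<lambda>n y. y + Suc n) n = triangle n" for n :: nat
    by (induction n) simp_all
  then show "rec_nat 0 (\<lambda>n y. y + Suc n) (F xs + G xs) + F xs = prod_encode (F xs, G xs)" for xs
    by (simp add: prod_encode_def)
qed

lemma decidable_mem_set_decode:
  assumes "total_rec k F" "total_rec k G"
  shows "decidable k (\<lambda>xs. F xs \<in> set_decode (G xs))"
proof (rule decidable_cong)
  show "decidable k (\<lambda>xs. \<exists>q<Suc (G xs). \<exists>r<2 ^ F xs. G xs = (q + q + 1) * 2 ^ F xs + r)"
    using assms
    by (intro decidable_ex_less decidable_eq total_rec_add total_rec_mult total_rec_power_2
        total_rec_const total_rec_Suc total_rec_tl total_rec_vars) simp_all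
next
  have "(\<exists>q<Suc m. \<exists>r<2 ^ n. m = (q + q + 1) * 2 ^ n + r) \<longleftrightarrow> n \<in> set_decode m" (is "?L \<longleftrightarrow> _") for m n :: nat
  proof
    assume ?L
    then obtain q r where r: "r < 2 ^ n" and m: "m = (q + q + 1) * 2 ^ n + r"
      by blast
    have "m div 2 ^ n = q + q + 1"
      unfolding m using r by (subst div_mult_self3) simp_all
    then show "n \<in> set_decode m"
      by (simp add: set_decode_def)
  next
    assume "n \<in> set_decode m"
    then have "odd (m div 2 ^ n)"
      by (simp add: set_decode_def)
    then obtain q where "m div 2 ^ n = 2 * q + 1"
      by (rule oddE)
    then have q: "m div 2 ^ n = q + q + 1"
      by simp
    have "m = (q + q + 1) * 2 ^ n + m mod 2 ^ n"
      unfolding q[symmetric] by (rule div_mult_mod_eq[symmetric])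
    moreover have "q \<le> m"
      using q div_le_dividend[of m "2 ^ n"] by linarith
    moreover have "m mod 2 ^ n < 2 ^ n"
      by simp
    ultimately show ?L
      using le_imp_less_Suc by blast
  qed
  then show "(\<exists>q<Suc (G xs). \<exists>r<2 ^ F xs. G xs = (q + q + 1) * 2 ^ F xs + r)
      \<longleftrightarrow> F xs \<in> set_decode (G xs)" for xs .
qed

section \<open>Codes of lists\<close>

lemma list_decode_cases:
  obtains "n = 0" "list_decode n = []"
  | x m where "n = Suc (prod_encode (x, m))" "list_decode n = x # list_decode m"
proof (cases n)
  case (Suc k)
  then show thesis
    using that(2)[of "fst (prod_decode k)" "snd (prod_decode k)"] by (auto split: prod.split)
qed (auto intro: that(1))

definition tl_code :: "nat \<Rightarrow> nat" where
  "tl_code n = list_encode (tl (list_decode n))"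

text \<open>At 0, the code of the empty list, the search for a first component stops at once with the value 0.\<close>

definition hd_code :: "nat \<Rightarrow> nat" where
  "hd_code n = (if n = 0 then 0 else hd (list_decode n))"

lemma total_rec_tl_code:
  assumes "total_rec k F"
  shows "total_rec k (\<lambda>xs. tl_code (F xs))"
proof (rule total_rec_cong)
  show "total_rec k (\<lambda>xs. LEAST m. F xs = 0 \<or> (\<exists>x<F xs. F xs = Suc (prod_encode (x, m))))"
  proof (rule total_rec_Least)
    show "decidable (Suc k)
        (\<lambda>ys. F (tl ys) = 0 \<or> (\<exists>x<F (tl ys). F (tl ys) = Suc (prod_encode (x, hd ys))))"
      by (intro decidable_disj decidable_eq decidable_ex_less total_rec_Suc total_rec_prod_encode
          total_rec_const total_rec_tl total_rec_vars assms) simp_all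
    show "\<exists>m. F xs = 0 \<or> (\<exists>x<F xs. F xs = Suc (prod_encode (x, m)))" for xs
      by (cases "F xs" rule: list_decode_cases) (auto simp: less_Suc_eq_le le_prod_encode_1)
  qed
next
  show "(LEAST m. F xs = 0 \<or> (\<exists>x<F xs. F xs = Suc (prod_encode (x, m)))) = tl_code (F xs)" for xs
    by (cases "F xs" rule: list_decode_cases)
      (auto simp: tl_code_def less_Suc_eq_le le_prod_encode_1 intro!: Least_equality)
qed

lemma total_rec_hd_code:
  assumes "total_rec k F"
  shows "total_rec k (\<lambda>xs. hd_code (F xs))"
proof (rule total_rec_cong)
  show "total_rec k (\<lambda>xs. LEAST x. F xs = 0 \<or> (\<exists>m<F xs. F xs = Suc (prod_encode (x, m))))"
  proof (rule total_rec_Least)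
    show "decidable (Suc k)
        (\<lambda>ys. F (tl ys) = 0 \<or> (\<exists>m<F (tl ys). F (tl ys) = Suc (prod_encode (hd ys, m))))"
      by (intro decidable_disj decidable_eq decidable_ex_less total_rec_Suc total_rec_prod_encode
          total_rec_const total_rec_tl total_rec_vars assms) simp_all
    show "\<exists>x. F xs = 0 \<or> (\<exists>m<F xs. F xs = Suc (prod_encode (x, m)))" for xs
      by (cases "F xs" rule: list_decode_cases) (auto simp: less_Suc_eq_le le_prod_encode_2)
  qed
next
  show "(LEAST x. F xs = 0 \<or> (\<exists>m<F xs. F xs = Suc (prod_encode (x, m)))) = hd_code (F xs)" for xs
    by (cases "F xs" rule: list_decode_cases)
      (auto simp: hd_code_def less_Suc_eq_le le_prod_encode_2 intro!: Least_equality)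
qed

definition drop_code :: "nat \<Rightarrow> nat \<Rightarrow> nat" where
  "drop_code i n = list_encode (drop i (list_decode n))"

lemma total_rec_drop_code:
  assumes "total_rec k I" "total_rec k F"
  shows "total_rec k (\<lambda>xs. drop_code (I xs) (F xs))"
proof (rule total_rec_cong)
  show "total_rec k (\<lambda>xs. rec_nat (F xs) (\<lambda>_ y. tl_code y) (I xs))"
    using assms by (intro total_rec_rec_nat total_rec_tl_code total_rec_vars) simp_all
next
  have "rec_nat n (\<lambda>_ y. tl_code y) i = drop_code i n" for i n
    by (induction i) (simp_all add: drop_code_def tl_code_def drop_Suc tl_drop)
  then show "rec_nat (F xs) (\<lambda>_ y. tl_code y) (I xs) = drop_code (I xs) (F xs)" for xs .
qed

definition nth_code :: "nat \<Rightarrow> nat \<Rightarrow> nat" where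
  "nth_code n i = hd_code (drop_code i n)"

lemma nth_code: "i < length l \<Longrightarrow> nth_code (list_encode l) i = l ! i"
  by (metis Cons_nth_drop_Suc drop_code_def hd_code_def list.sel(1) list_encode.simps(2)
      list_encode_inverse nat.distinct(1) nth_code_def)

lemma total_rec_nth_code:
  assumes "total_rec k I" "total_rec k F"
  shows "total_rec k (\<lambda>xs. nth_code (F xs) (I xs))"
  unfolding nth_code_def by (intro total_rec_hd_code total_rec_drop_code assms)

definition length_code :: "nat \<Rightarrow> nat" where
  "length_code n = length (list_decode n)"

lemma drop_code_eq_0_iff: "drop_code i n = 0 \<longleftrightarrow> length_code n \<le> i"
  by (metis drop_code_def drop_eq_Nil length_code_def list_encode.simps(1) list_encode_eq)

lemma total_rec_length_code:
  assumes "total_rec k F"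
  shows "total_rec k (\<lambda>xs. length_code (F xs))"
proof (rule total_rec_cong)
  show "total_rec k (\<lambda>xs. LEAST i. drop_code i (F xs) = 0)"
  proof (rule total_rec_Least)
    show "decidable (Suc k) (\<lambda>ys. drop_code (hd ys) (F (tl ys)) = 0)"
      by (intro decidable_eq total_rec_drop_code total_rec_const total_rec_tl total_rec_vars assms)
        simp_all
  qed (auto simp: drop_code_eq_0_iff)
  show "(LEAST i. drop_code i (F xs) = 0) = length_code (F xs)" for xs
    by (auto simp: drop_code_eq_0_iff intro: Least_equality)
qed

definition append_code :: "nat \<Rightarrow> nat \<Rightarrow> nat" where
  "append_code m n = list_encode (list_decode m @ list_decode n)"

text \<open>The first list is consumed from its end, so that each step of the recursion is a single cons
  onto the result obtained so far.\<close>

lemma total_rec_append_code: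
  assumes "total_rec k F" "total_rec k G"
  shows "total_rec k (\<lambda>xs. append_code (F xs) (G xs))"
proof (rule total_rec_cong)
  show "total_rec k (\<lambda>xs. rec_nat (G xs)
      (\<lambda>i y. Suc (prod_encode (nth_code (F xs) (length_code (F xs) - Suc i), y))) (length_code (F xs)))"
    by (intro total_rec_rec_nat total_rec_Suc total_rec_prod_encode total_rec_nth_code total_rec_diff
        total_rec_length_code total_rec_tl total_rec_vars assms) simp_all
next
  fix xs :: "nat list"
  let ?m = "list_decode (F xs)"
  have "rec_nat (G xs) (\<lambda>i y. Suc (prod_encode (nth_code (F xs) (length_code (F xs) - Suc i), y))) i
      = list_encode (drop (length ?m - i) ?m @ list_decode (G xs))" if "i \<le> length ?m" for i
    using that
  proof (induction i)
    case (Suc i)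
    moreover have "nth_code (F xs) (length ?m - Suc i) = ?m ! (length ?m - Suc i)"
      using nth_code[of "length ?m - Suc i" ?m] Suc.prems by simp
    moreover have "drop (length ?m - Suc i) ?m = ?m ! (length ?m - Suc i) # drop (length ?m - i) ?m"
      using Suc.prems by (simp add: Cons_nth_drop_Suc[symmetric] Suc_diff_Suc)
    ultimately show ?case
      by (simp add: length_code_def)
  qed simp
  then show "rec_nat (G xs) (\<lambda>i y. Suc (prod_encode (nth_code (F xs) (length_code (F xs) - Suc i), y)))
      (length_code (F xs)) = append_code (F xs) (G xs)"
    by (simp add: length_code_def append_code_def)
qed

section \<open>\<open>\<Sigma>\<^sub>1\<close> predicates and recursive enumerability\<close>

text \<open>Simultaneous substitutions of total recursive functions for \<open>m\<close> variables.\<close>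

definition total_rec_list :: "nat \<Rightarrow> nat \<Rightarrow> (nat list \<Rightarrow> nat list) \<Rightarrow> bool" where
  "total_rec_list k m H \<longleftrightarrow>
     (\<forall>xs. length xs = k \<longrightarrow> length (H xs) = m) \<and> (\<forall>i<m. total_rec k (\<lambda>xs. H xs ! i))"

lemma total_rec_list_id: "total_rec_list k k (\<lambda>xs. xs)"
  by (simp add: total_rec_list_def total_rec_nth)

lemma total_rec_list_tl:
  assumes "total_rec_list k (Suc m) H"
  shows "total_rec_list k m (\<lambda>xs. tl (H xs))"
  unfolding total_rec_list_def
proof (intro conjI allI impI)
  fix i
  assume "i < m"
  then have "total_rec k (\<lambda>xs. H xs ! Suc i)"
    using assms by (auto simp: total_rec_list_def)
  then show "total_rec k (\<lambda>xs. tl (H xs) ! i)"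
    by (rule total_rec_cong) (use assms \<open>i < m\<close> in \<open>simp add: nth_tl total_rec_list_def\<close>)
qed (use assms in \<open>auto simp: total_rec_list_def\<close>)

lemma total_rec_list_Cons:
  assumes "total_rec k F" "total_rec_list k m H"
  shows "total_rec_list k (Suc m) (\<lambda>xs. F xs # H xs)"
  unfolding total_rec_list_def
proof (intro conjI allI impI)
  fix i
  assume "i < Suc m"
  then show "total_rec k (\<lambda>xs. (F xs # H xs) ! i)"
    using assms by (cases i) (auto simp: total_rec_list_def)
qed (use assms in \<open>auto simp: total_rec_list_def\<close>)

lemma total_rec_subst:
  assumes "total_rec m F" "total_rec_list k m H"
  shows "total_rec k (\<lambda>xs. F (H xs))"
proof (rule total_rec_cong)
  show "total_rec k (\<lambda>xs. F (map (\<lambda>G. G xs) (map (\<lambda>i xs. H xs ! i) [0..<m])))"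
    using assms by (intro total_rec_compose) (auto simp: total_rec_list_def)
next
  fix xs :: "nat list"
  assume "length xs = k"
  then have "map (\<lambda>G. G xs) (map (\<lambda>i xs. H xs ! i) [0..<m]) = H xs"
    using assms(2) by (intro nth_equalityI) (auto simp: total_rec_list_def)
  then show "F (map (\<lambda>G. G xs) (map (\<lambda>i xs. H xs ! i) [0..<m])) = F (H xs)"
    by simp
qed

lemma decidable_subst:
  assumes "decidable m P" "total_rec_list k m H"
  shows "decidable k (\<lambda>xs. P (H xs))"
  using total_rec_subst[of m "\<lambda>xs. if P xs then 0 else 1"] assms unfolding decidable_def by blast

definition sigma1 :: "nat \<Rightarrow> (nat list \<Rightarrow> bool) \<Rightarrow> bool" where
  "sigma1 k P \<longleftrightarrow> (\<exists>Q. decidable (Suc k) Q \<and> (\<forall>xs. length xs = k \<longrightarrow> (P xs \<longleftrightarrow> (\<exists>t. Q (t # xs)))))"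

lemma sigma1_cong:
  assumes "sigma1 k P" and "\<And>xs. length xs = k \<Longrightarrow> P xs \<longleftrightarrow> P' xs"
  shows "sigma1 k P'"
proof -
  obtain Q where "decidable (Suc k) Q" "\<And>xs. length xs = k \<Longrightarrow> P xs \<longleftrightarrow> (\<exists>t. Q (t # xs))"
    using assms(1) unfolding sigma1_def by blast
  then show ?thesis
    unfolding sigma1_def using assms(2) by (intro exI[of _ Q]) auto
qed

text \<open>Replacing ``\<open>t\<close> is a witness'' by ``some witness is below \<open>t\<close>'' makes witnesses upward closed.
  Hence finitely many existential statements have a common witness, which makes pairing and sequence
  coding superfluous in the closure properties.\<close>

lemma sigma1_monotone_witness:
  assumes "sigma1 k P"
  obtains Q where "decidable (Suc k) Q"
    "\<And>xs. length xs = k \<Longrightarrow> P xs \<longleftrightarrow> (\<exists>t. Q (t # xs))"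
    "\<And>xs s t. Q (s # xs) \<Longrightarrow> s \<le> t \<Longrightarrow> Q (t # xs)"
proof -
  obtain Q where Q: "decidable (Suc k) Q"
    "\<And>xs. length xs = k \<Longrightarrow> P xs \<longleftrightarrow> (\<exists>t. Q (t # xs))"
    using assms unfolding sigma1_def by blast
  let ?Q = "\<lambda>ys. \<exists>s<hd ys. Q (s # tl ys)"
  have "decidable (Suc (Suc k)) (\<lambda>zs. Q (hd zs # tl (tl zs)))"
    by (intro decidable_subst[OF Q(1)] total_rec_list_Cons total_rec_list_tl total_rec_list_id
        total_rec_vars) simp
  then have "decidable (Suc k) ?Q"
    by (intro decidable_ex_less total_rec_vars) simp_all
  moreover have "P xs \<longleftrightarrow> (\<exists>t. ?Q (t # xs))" if "length xs = k" for xs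
    using Q(2)[OF that] lessI by auto
  moreover have "?Q (t # xs)" if "?Q (s # xs)" "s \<le> t" for xs s t
    using that less_le_trans by auto
  ultimately show thesis
    by (rule that)
qed

lemma sigma1_decidable:
  assumes "decidable k P"
  shows "sigma1 k P"
  unfolding sigma1_def by (rule exI[of _ "\<lambda>ys. P (tl ys)"]) (simp add: decidable_tl assms)

lemma sigma1_subst:
  assumes "sigma1 m P" "total_rec_list k m H"
  shows "sigma1 k (\<lambda>xs. P (H xs))"
proof -
  obtain Q where Q: "decidable (Suc m) Q"
    "\<And>xs. length xs = m \<Longrightarrow> P xs \<longleftrightarrow> (\<exists>t. Q (t # xs))"
    using assms(1) unfolding sigma1_def by blast
  have "total_rec_list (Suc k) m (\<lambda>ys. H (tl ys))"
    using assms(2) unfolding total_rec_list_def by (auto intro: total_rec_tl[of k "\<lambda>xs. H xs ! _"])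
  then have "decidable (Suc k) (\<lambda>ys. Q (hd ys # H (tl ys)))"
    by (intro decidable_subst[OF Q(1)] total_rec_list_Cons total_rec_vars) simp
  moreover have "P (H xs) \<longleftrightarrow> (\<exists>t. Q (t # H xs))" if "length xs = k" for xs
    using that assms(2) Q(2) unfolding total_rec_list_def by blast
  ultimately show ?thesis
    unfolding sigma1_def by (intro exI[of _ "\<lambda>ys. Q (hd ys # H (tl ys))"]) simp
qed

lemma sigma1_conj:
  assumes "sigma1 k P" "sigma1 k P'"
  shows "sigma1 k (\<lambda>xs. P xs \<and> P' xs)"
proof -
  obtain Q where Q: "decidable (Suc k) Q" "\<And>xs. length xs = k \<Longrightarrow> P xs \<longleftrightarrow> (\<exists>t. Q (t # xs))"
    "\<And>xs s t. Q (s # xs) \<Longrightarrow> s \<le> t \<Longrightarrow> Q (t # xs)"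
    by (rule sigma1_monotone_witness[OF assms(1)]) blast
  obtain Q' where Q': "decidable (Suc k) Q'" "\<And>xs. length xs = k \<Longrightarrow> P' xs \<longleftrightarrow> (\<exists>t. Q' (t # xs))"
    "\<And>xs s t. Q' (s # xs) \<Longrightarrow> s \<le> t \<Longrightarrow> Q' (t # xs)"
    by (rule sigma1_monotone_witness[OF assms(2)]) blast
  have "(P xs \<and> P' xs) \<longleftrightarrow> (\<exists>t. Q (t # xs) \<and> Q' (t # xs))" if "length xs = k" for xs
    using Q(2)[OF that] Q'(2)[OF that] Q(3) Q'(3) by (meson nle_le)
  then show ?thesis
    unfolding sigma1_def using decidable_conj[OF Q(1) Q'(1)] by (intro exI conjI) auto
qed

lemma sigma1_disj:
  assumes "sigma1 k P" "sigma1 k P'"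
  shows "sigma1 k (\<lambda>xs. P xs \<or> P' xs)"
proof -
  obtain Q where Q: "decidable (Suc k) Q" "\<And>xs. length xs = k \<Longrightarrow> P xs \<longleftrightarrow> (\<exists>t. Q (t # xs))"
    using assms(1) unfolding sigma1_def by blast
  obtain Q' where Q': "decidable (Suc k) Q'" "\<And>xs. length xs = k \<Longrightarrow> P' xs \<longleftrightarrow> (\<exists>t. Q' (t # xs))"
    using assms(2) unfolding sigma1_def by blast
  show ?thesis
    unfolding sigma1_def using decidable_disj[OF Q(1) Q'(1)] Q(2) Q'(2)
    by (intro exI[of _ "\<lambda>ys. Q ys \<or> Q' ys"]) auto
qed

text \<open>A common bound on the witness and on the quantified variable merges the two quantifiers into one.\<close>

lemma sigma1_ex:
  assumes "sigma1 (Suc k) (\<lambda>ys. P (hd ys) (tl ys))"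
  shows "sigma1 k (\<lambda>xs. \<exists>a. P a xs)"
proof -
  obtain Q where Q: "decidable (Suc (Suc k)) Q"
    "\<And>ys. length ys = Suc k \<Longrightarrow> P (hd ys) (tl ys) \<longleftrightarrow> (\<exists>t. Q (t # ys))"
    using assms unfolding sigma1_def by blast
  let ?Q = "\<lambda>ys. \<exists>t<hd ys. \<exists>a<hd ys. Q (t # a # tl ys)"
  have "decidable (Suc (Suc (Suc k))) (\<lambda>zs. Q (hd (tl zs) # hd zs # tl (tl (tl zs))))"
    by (intro decidable_subst[OF Q(1)] total_rec_list_Cons total_rec_list_tl total_rec_list_id
        total_rec_vars) simp_all
  then have "decidable (Suc k) ?Q"
    by (intro decidable_ex_less total_rec_vars) simp_all
  moreover have "(\<exists>a. P a xs) \<longleftrightarrow> (\<exists>b. ?Q (b # xs))" if "length xs = k" for xs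
  proof -
    have "P a xs \<longleftrightarrow> (\<exists>t. Q (t # a # xs))" for a
      using Q(2)[of "a # xs"] that by simp
    moreover have "\<exists>b. ?Q (b # xs)" if "Q (t # a # xs)" for t a
    proof -
      have "t < Suc (max t a)" "a < Suc (max t a)"
        by simp_all
      with that show ?thesis
        unfolding list.sel by blast
    qed
    ultimately show ?thesis
      by auto
  qed
  ultimately show ?thesis
    unfolding sigma1_def by blast
qed

text \<open>Collection: the finitely many witnesses have a common upper bound, so the existential quantifier
  moves in front of the bounded universal one.\<close>

lemma sigma1_all_less:
  assumes "sigma1 (Suc k) (\<lambda>ys. P (hd ys) (tl ys))" and "total_rec k N"
  shows "sigma1 k (\<lambda>xs. \<forall>i<N xs. P i xs)"
proof -
  obtain Q where Q: "decidable (Suc (Suc k)) Q"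
    "\<And>ys. length ys = Suc k \<Longrightarrow> P (hd ys) (tl ys) \<longleftrightarrow> (\<exists>t. Q (t # ys))"
    "\<And>ys s t. Q (s # ys) \<Longrightarrow> s \<le> t \<Longrightarrow> Q (t # ys)"
    by (rule sigma1_monotone_witness[OF assms(1)]) blast
  let ?Q = "\<lambda>ys. \<forall>i<N (tl ys). Q (hd ys # i # tl ys)"
  have "decidable (Suc (Suc k)) (\<lambda>zs. Q (hd (tl zs) # hd zs # tl (tl zs)))"
    by (intro decidable_subst[OF Q(1)] total_rec_list_Cons total_rec_list_tl total_rec_list_id
        total_rec_vars) simp_all
  then have "decidable (Suc k) ?Q"
    by (intro decidable_all_less total_rec_tl assms) simp_all
  moreover have "(\<forall>i<N xs. P i xs) \<longleftrightarrow> (\<exists>b. ?Q (b # xs))" if "length xs = k" for xs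
  proof -
    have P: "P i xs \<longleftrightarrow> (\<exists>t. Q (t # i # xs))" for i
      using Q(2)[of "i # xs"] that by simp
    have "\<exists>b. \<forall>i<n. Q (b # i # xs)" if "\<forall>i<n. \<exists>t. Q (t # i # xs)" for n
      using that
    proof (induction n)
      case (Suc n)
      then obtain b t where "\<forall>i<n. Q (b # i # xs)" "Q (t # n # xs)"
        by auto
      then have "\<forall>i<Suc n. Q (max b t # i # xs)"
        using Q(3) by (metis less_Suc_eq max.cobounded1 max.cobounded2)
      then show ?case ..
    qed simp
    then show ?thesis
      by (auto simp: P)
  qed
  ultimately show ?thesis
    unfolding sigma1_def by blast
qed

lemma sigma1_finite_Ball:
  assumes "finite B" and "\<And>b. b \<in> B \<Longrightarrow> sigma1 k (P b)"
  shows "sigma1 k (\<lambda>xs. \<forall>b\<in>B. P b xs)"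
  using assms
  by (induction B rule: finite_induct)
    (simp_all add: sigma1_decidable decidable_const sigma1_conj)

lemma sigma1_finite_Bex:
  assumes "finite B" and "\<And>b. b \<in> B \<Longrightarrow> sigma1 k (P b)"
  shows "sigma1 k (\<lambda>xs. \<exists>b\<in>B. P b xs)"
  using assms
  by (induction B rule: finite_induct)
    (simp_all add: sigma1_decidable decidable_const sigma1_disj)

text \<open>An unbounded search for the witness halts exactly on the elements of the set.\<close>

lemma rec_enumerable_if_sigma1:
  assumes "sigma1 1 (\<lambda>xs. hd xs \<in> N)"
  shows "rec_enumerable N"
proof -
  obtain Q where "decidable (Suc 1) Q"
    and Q: "\<And>xs. length xs = 1 \<Longrightarrow> hd xs \<in> N \<longleftrightarrow> (\<exists>t. Q (t # xs))"
    using assms unfolding sigma1_def by blast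
  then obtain f where f: "\<And>ys. length ys = Suc 1 \<Longrightarrow> computes f ys (if Q ys then 0 else 1)"
    unfolding decidable_def total_rec_def by blast
  have "n \<in> N \<longleftrightarrow> (\<exists>y. computes (Mu f) [n] y)" for n
  proof
    assume "n \<in> N"
    then have ex: "\<exists>t. Q [t, n]"
      using Q[of "[n]"] by simp
    have "computes (Mu f) [n] (LEAST t. Q [t, n])"
    proof (rule computes.mu)
      show "computes f [LEAST t. Q [t, n], n] 0"
        using f[of "[LEAST t. Q [t, n], n]"] LeastI_ex[OF ex] by simp
      show "\<forall>m<LEAST t. Q [t, n]. \<exists>y. computes f [m, n] (Suc y)"
      proof (intro allI impI)
        fix m
        assume "m < (LEAST t. Q [t, n])"
        then have "\<not> Q [m, n]"
          by (rule not_less_Least)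
        then show "\<exists>y. computes f [m, n] (Suc y)"
          using f[of "[m, n]"] by auto
      qed
    qed
    then show "\<exists>y. computes (Mu f) [n] y" ..
  next
    assume "\<exists>y. computes (Mu f) [n] y"
    then obtain t where "computes f [t, n] 0"
      by (auto elim: computes.cases)
    then have "Q [t, n]"
      using computes_deterministic[OF f[of "[t, n]"], of 0] by (auto split: if_splits)
    then show "n \<in> N"
      using Q[of "[n]"] by auto
  qed
  then show ?thesis
    unfolding rec_enumerable_def by blast
qed

text \<open>The intermediate values of a composition form a tuple whose length is known in advance, so that
  quantifying over it is an iterated number quantifier.\<close>

lemma sigma1_ex_list:
  assumes "sigma1 (n + k) P"
  shows "sigma1 k (\<lambda>xs. \<exists>zs. length zs = n \<and> P (zs @ xs))"
  using assms
proof (induction n arbitrary: P)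
  case 0
  then show ?case by simp
next
  case (Suc n)
  have "sigma1 (Suc (n + k)) (\<lambda>ys. P (hd ys # tl ys))"
    using Suc.prems unfolding add_Suc by (rule sigma1_cong) (metis Zero_not_Suc hd_Cons_tl list.size(3))
  then have "sigma1 (n + k) (\<lambda>xs. \<exists>a. P (a # xs))"
    by (rule sigma1_ex)
  then have "sigma1 k (\<lambda>xs. \<exists>zs. length zs = n \<and> (\<exists>a. P (a # zs @ xs)))"
    by (rule Suc.IH)
  moreover have "(\<exists>zs. length zs = n \<and> (\<exists>a. P (a # zs @ xs))) \<longleftrightarrow>
      (\<exists>zs. length zs = Suc n \<and> P (zs @ xs))" (is "?L \<longleftrightarrow> ?R") for xs
  proof
    assume ?L
    then obtain zs a where "length zs = n" "P (a # zs @ xs)"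
      by blast
    then show ?R
      by (intro exI[of _ "a # zs"]) simp
  next
    assume ?R
    then obtain zs where "length zs = Suc n" "P (zs @ xs)"
      by blast
    then show ?L
      by (cases zs) auto
  qed
  ultimately show ?case
    by simp
qed

lemma computes_Zero_iff: "computes Zero xs y \<longleftrightarrow> y = 0"
  by (subst computes.simps) simp

lemma computes_Succ_iff: "computes Succ xs y \<longleftrightarrow> xs \<noteq> [] \<and> y = Suc (hd xs)"
  by (subst computes.simps) (auto simp: neq_Nil_conv)

lemma computes_Proj_iff: "computes (Proj i) xs y \<longleftrightarrow> i < length xs \<and> y = xs ! i"
  by (subst computes.simps) auto

lemma computes_Comp_iff:
  "computes (Comp f gs) xs y \<longleftrightarrow> (\<exists>zs. length zs = length gs \<and>
     (\<forall>i<length gs. computes (gs ! i) xs (zs ! i)) \<and> computes f zs y)"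
  by (subst computes.simps) (auto simp: list_all2_conv_all_nth eq_commute[of "length gs"])

lemma not_computes_PrimRec_Nil: "\<not> computes (PrimRec f g) [] y"
  by (subst computes.simps) simp

lemma computes_Mu_iff:
  "computes (Mu f) xs y \<longleftrightarrow>
     computes f (y # xs) 0 \<and> (\<forall>m<y. \<exists>z. computes f (m # xs) (Suc z))"
  by (subst computes.simps) auto

text \<open>The sequence \<open>s\<close> lists the values of the recursion at the arguments \<open>0, \<dots>, n\<close>. Its values beyond
  \<open>n\<close> do not matter, so a code of a finite list can represent it.\<close>

lemma computes_PrimRec_iff:
  "computes (PrimRec f g) (n # xs) y \<longleftrightarrow>
     (\<exists>s. computes f xs (s 0) \<and> (\<forall>i<n. computes g (i # s i # xs) (s (Suc i))) \<and> y = s n)"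
proof (induction n arbitrary: y)
  case 0
  show ?case
  proof
    assume "computes (PrimRec f g) (0 # xs) y"
    then have "computes f xs y"
      by cases auto
    then show "\<exists>s. computes f xs (s 0) \<and> (\<forall>i<0. computes g (i # s i # xs) (s (Suc i))) \<and> y = s 0"
      by (intro exI[of _ "\<lambda>_. y"]) simp
  qed (auto intro: computes.prim_0)
next
  case (Suc n)
  show ?case
  proof
    assume "computes (PrimRec f g) (Suc n # xs) y"
    then obtain z where "computes (PrimRec f g) (n # xs) z" and y: "computes g (n # z # xs) y"
      by cases auto
    then obtain s where "computes f xs (s 0)" "\<forall>i<n. computes g (i # s i # xs) (s (Suc i))" "z = s n"
      using Suc.IH by blast
    then show "\<exists>s. computes f xs (s 0) \<and> (\<forall>i<Suc n. computes g (i # s i # xs) (s (Suc i))) \<and> y = s (Suc n)"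
      using y by (intro exI[of _ "s(Suc n := y)"]) (auto simp: less_Suc_eq)
  next
    assume "\<exists>s. computes f xs (s 0) \<and> (\<forall>i<Suc n. computes g (i # s i # xs) (s (Suc i))) \<and> y = s (Suc n)"
    then obtain s where "computes f xs (s 0)" "\<forall>i<Suc n. computes g (i # s i # xs) (s (Suc i))" "y = s (Suc n)"
      by blast
    moreover from this have "computes (PrimRec f g) (n # xs) (s n)"
      using Suc.IH by auto
    ultimately show "computes (PrimRec f g) (Suc n # xs) y"
      by (auto intro: computes.prim_Suc)
  qed
qed

lemma computes_PrimRec_iff_code:
  "computes (PrimRec f g) (n # xs) y \<longleftrightarrow>
     (\<exists>c. computes f xs (nth_code c 0) \<and>
        (\<forall>i<n. computes g (i # nth_code c i # xs) (nth_code c (Suc i))) \<and> y = nth_code c n)"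
    (is "_ \<longleftrightarrow> (\<exists>c. ?R (nth_code c))")
proof -
  have "\<exists>c. ?R (nth_code c)" if "?R s" for s
  proof -
    \<comment> \<open>the value at \<open>n\<close> itself is needed, hence \<open>n + 1\<close> entries\<close>
    have "nth_code (list_encode (map s [0..<Suc n])) i = s i" if "i \<le> n" for i
      using that by (subst nth_code) (auto simp del: upt_Suc simp: nth_map_upt)
    then show ?thesis
      using that by (intro exI[of _ "list_encode (map s [0..<Suc n])"]) auto
  qed
  then show ?thesis
    unfolding computes_PrimRec_iff by blast
qed

lemma total_rec_list_take_drop:
  assumes "n + m \<le> k"
  shows "total_rec_list k m (\<lambda>xs. take m (drop n xs))"
  unfolding total_rec_list_def
proof (intro conjI allI impI)
  fix i
  assume "i < m"
  then have "total_rec k (\<lambda>xs. xs ! (n + i))"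
    using assms by (intro total_rec_nth) simp
  then show "total_rec k (\<lambda>xs. take m (drop n xs) ! i)"
    by (rule total_rec_cong) (use assms \<open>i < m\<close> in simp)
qed (use assms in auto)

text \<open>The value is the first variable and the arguments are the remaining ones. Induction on the
  function term; each clause of \<^const>\<open>computes\<close> is a \<open>\<Sigma>\<^sub>1\<close> condition on the graphs of the
  immediate subterms.\<close>

lemma sigma1_computes: "sigma1 (Suc k) (\<lambda>ys. computes f (tl ys) (hd ys))"
proof (induction f arbitrary: k)
  case Zero
  have "sigma1 (Suc k) (\<lambda>ys. hd ys = 0)"
    by (intro sigma1_decidable decidable_eq total_rec_const total_rec_vars) simp
  then show ?case
    by (rule sigma1_cong) (simp add: computes_Zero_iff)
next
  case Succ
  show ?case
  proof (cases k)
    case 0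
    show ?thesis
      unfolding 0 by (rule sigma1_cong[OF sigma1_decidable[OF decidable_const[of _ False]]])
        (auto simp: length_Suc_conv computes_Succ_iff)
  next
    case (Suc k')
    have "sigma1 (Suc k) (\<lambda>ys. hd ys = Suc (hd (tl ys)))"
      unfolding Suc by (intro sigma1_decidable decidable_eq total_rec_Suc total_rec_vars) simp_all
    then show ?thesis
      unfolding Suc
      by (rule sigma1_cong) (auto simp: length_Suc_conv computes_Succ_iff)
  qed
next
  case (Proj i)
  show ?case
  proof (cases "i < k")
    case False
    show ?thesis
      by (rule sigma1_cong[OF sigma1_decidable[OF decidable_const[of _ False]]])
        (use False in \<open>simp add: computes_Proj_iff\<close>)
  next
    case True
    have "sigma1 (Suc k) (\<lambda>ys. hd ys = tl ys ! i)"
      using True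
      by (intro sigma1_decidable decidable_eq total_rec_tl[of k "\<lambda>xs. xs ! i"] total_rec_nth
          total_rec_vars) simp_all
    then show ?thesis
      by (rule sigma1_cong) (use True in \<open>simp add: computes_Proj_iff\<close>)
  qed
next
  case (Comp f gs)
  let ?n = "length gs"
  \<comment> \<open>the variables are the intermediate values, then the value, then the arguments\<close>
  let ?P = "\<lambda>ws. (\<forall>i\<in>{..<?n}. computes (gs ! i) (drop (Suc ?n) ws) (ws ! i)) \<and>
    computes f (take ?n ws) (ws ! ?n)"
  have "sigma1 (?n + Suc k) ?P"
  proof (intro sigma1_conj sigma1_finite_Ball)
    fix i
    assume i: "i \<in> {..<?n}"
    have H: "total_rec_list (?n + Suc k) (Suc k) (\<lambda>ws. ws ! i # take k (drop (Suc ?n) ws))"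
      using i by (intro total_rec_list_Cons total_rec_nth total_rec_list_take_drop) simp_all
    have "sigma1 (Suc k) (\<lambda>ys. computes (gs ! i) (tl ys) (hd ys))"
      using i by (intro Comp.IH(2) nth_mem) simp
    from sigma1_subst[OF this H]
    show "sigma1 (?n + Suc k) (\<lambda>ws. computes (gs ! i) (drop (Suc ?n) ws) (ws ! i))"
      by (rule sigma1_cong) simp
  next
    have "total_rec_list (?n + Suc k) (Suc ?n) (\<lambda>ws. ws ! ?n # take ?n (drop 0 ws))"
      by (intro total_rec_list_Cons total_rec_nth total_rec_list_take_drop) simp_all
    from sigma1_subst[OF Comp.IH(1) this]
    show "sigma1 (?n + Suc k) (\<lambda>ws. computes f (take ?n ws) (ws ! ?n))"
      by simp
  qed simp
  then have "sigma1 (Suc k) (\<lambda>ys. \<exists>zs. length zs = ?n \<and> ?P (zs @ ys))"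
    by (rule sigma1_ex_list)
  then show ?case
  proof (rule sigma1_cong)
    fix ys :: "nat list"
    assume "length ys = Suc k"
    then obtain y xs where ys: "ys = y # xs"
      by (cases ys) auto
    show "(\<exists>zs. length zs = ?n \<and> ?P (zs @ ys)) \<longleftrightarrow> computes (Comp f gs) (tl ys) (hd ys)"
      unfolding ys computes_Comp_iff
      by (intro ex_cong1 conj_cong refl) (simp_all add: nth_append lessThan_def)
  qed
next
  case (PrimRec f g)
  show ?case
  proof (cases k)
    case 0
    show ?thesis
      unfolding 0 by (rule sigma1_cong[OF sigma1_decidable[OF decidable_const[of _ False]]])
        (auto simp: length_Suc_conv not_computes_PrimRec_Nil)
  next
    case (Suc m)
    let ?H = "\<lambda>zs. nth_code (hd zs) 0 # tl (tl (tl zs))"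
    let ?K = "\<lambda>ws. nth_code (hd (tl ws)) (Suc (hd ws)) # hd ws # nth_code (hd (tl ws)) (hd ws) #
      tl (tl (tl (tl ws)))"
    have H: "total_rec_list (Suc (Suc (Suc m))) (Suc m) ?H"
      by (intro total_rec_list_Cons total_rec_list_tl total_rec_list_id total_rec_nth_code
          total_rec_const total_rec_vars) simp_all
    have K: "total_rec_list (Suc (Suc (Suc (Suc m)))) (Suc (Suc (Suc m))) ?K"
      by (intro total_rec_list_Cons total_rec_list_tl total_rec_list_id total_rec_nth_code
          total_rec_Suc total_rec_vars) simp_all
    have "sigma1 (Suc (Suc m)) (\<lambda>ys. \<exists>c. computes f (tl (tl ys)) (nth_code c 0) \<and>
        (\<forall>i<hd (tl ys). computes g (i # nth_code c i # tl (tl ys)) (nth_code c (Suc i))) \<and>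
        hd ys = nth_code c (hd (tl ys)))"
    proof (intro sigma1_ex sigma1_conj sigma1_all_less)
      show "sigma1 (Suc (Suc (Suc m))) (\<lambda>zs. computes f (tl (tl (tl zs))) (nth_code (hd zs) 0))"
        using sigma1_subst[OF PrimRec.IH(1) H] by simp
      show "sigma1 (Suc (Suc (Suc (Suc m)))) (\<lambda>ws. computes g
          (hd ws # nth_code (hd (tl ws)) (hd ws) # tl (tl (tl (tl ws)))) (nth_code (hd (tl ws)) (Suc (hd ws))))"
        using sigma1_subst[OF PrimRec.IH(2) K] by simp
      show "sigma1 (Suc (Suc (Suc m))) (\<lambda>zs. hd (tl zs) = nth_code (hd zs) (hd (tl (tl zs))))"
        by (intro sigma1_decidable decidable_eq total_rec_nth_code total_rec_vars) simp_all
    qed (intro total_rec_vars, simp)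
    then show ?thesis
      unfolding Suc
      by (rule sigma1_cong) (auto simp: length_Suc_conv computes_PrimRec_iff_code)
  qed
next
  case (Mu f)
  let ?H = "\<lambda>ys. 0 # hd ys # tl ys"
  let ?K = "\<lambda>ws. Suc (hd ws) # hd (tl ws) # tl (tl (tl ws))"
  have H: "total_rec_list (Suc k) (Suc (Suc k)) ?H"
    by (intro total_rec_list_Cons total_rec_list_tl total_rec_list_id total_rec_const total_rec_vars) simp
  have K: "total_rec_list (Suc (Suc (Suc k))) (Suc (Suc k)) ?K"
    by (intro total_rec_list_Cons total_rec_list_tl total_rec_list_id total_rec_Suc total_rec_vars) simp_all
  have "sigma1 (Suc k) (\<lambda>ys. computes f (hd ys # tl ys) 0 \<and>
      (\<forall>m<hd ys. \<exists>y. computes f (m # tl ys) (Suc y)))"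
  proof (intro sigma1_ex sigma1_conj sigma1_all_less)
    show "sigma1 (Suc k) (\<lambda>ys. computes f (hd ys # tl ys) 0)"
      using sigma1_subst[OF Mu.IH H] by simp
    show "sigma1 (Suc (Suc (Suc k))) (\<lambda>ws. computes f (hd (tl ws) # tl (tl (tl ws))) (Suc (hd ws)))"
      using sigma1_subst[OF Mu.IH K] by simp
  qed (intro total_rec_vars, simp)
  then show ?case
    by (rule sigma1_cong) (simp add: computes_Mu_iff)
qed

lemma sigma1_rec_enumerable:
  assumes "rec_enumerable N" "total_rec k F"
  shows "sigma1 k (\<lambda>xs. F xs \<in> N)"
proof -
  obtain f where f: "\<And>n. n \<in> N \<longleftrightarrow> (\<exists>y. computes f [n] y)"
    using assms(1) unfolding rec_enumerable_def by blast
  have "total_rec_list (Suc k) 0 (\<lambda>ys. [])"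
    by (simp add: total_rec_list_def)
  then have "total_rec_list (Suc k) (Suc 1) (\<lambda>ys. [hd ys, F (tl ys)])"
    unfolding One_nat_def by (intro total_rec_list_Cons total_rec_tl[OF assms(2)] total_rec_vars) simp_all
  then have "sigma1 (Suc k) (\<lambda>ys. computes f (tl [hd ys, F (tl ys)]) (hd [hd ys, F (tl ys)]))"
    by (intro sigma1_subst[OF sigma1_computes])
  then have "sigma1 (Suc k) (\<lambda>ys. computes f [F (tl ys)] (hd ys))"
    by simp
  then have "sigma1 k (\<lambda>xs. \<exists>y. computes f [F xs] y)"
    by (rule sigma1_ex)
  then show ?thesis
    by (simp add: f)
qed

section \<open>Compactness for sets of numbers\<close>

text \<open>Koenig's lemma for the binary tree: think of \<open>Q N T\<close> as saying that the truth assignment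
  \<open>T\<close> violates no constraint visible below \<open>N\<close>. The assignment is extended one number at a time, keeping the
  invariant that it has admissible extensions of every length.\<close>

lemma koenig_nat_sets:
  fixes Q :: "nat \<Rightarrow> nat set \<Rightarrow> bool"
  assumes ex: "\<And>N. \<exists>T\<subseteq>{..<N}. Q N T"
    and restrict: "\<And>M N T. Q N T \<Longrightarrow> M \<le> N \<Longrightarrow> Q M (T \<inter> {..<M})"
  shows "\<exists>T. \<forall>N. Q N (T \<inter> {..<N})"
proof -
  \<comment> \<open>\<open>s\<close> is the trace below \<open>n\<close> of admissible sets for all later bounds\<close>
  define E where "E n s \<longleftrightarrow> (\<forall>M\<ge>n. \<exists>t. Q M t \<and> t \<inter> {..<n} = s)" for n s
  have "\<exists>f. \<forall>n. E n (f n) \<and> f (Suc n) \<inter> {..<n} = f n"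
  proof (rule dependent_nat_choice)
    show "\<exists>s. E 0 s"
      using ex unfolding E_def by (intro exI[of _ "{}"]) auto
  next
    fix s n
    assume E: "E n s"
    show "\<exists>s'. E (Suc n) s' \<and> s' \<inter> {..<n} = s"
    proof (rule ccontr)
      assume no: "\<not> ?thesis"
      have s: "s \<subseteq> {..<n}"
        using E unfolding E_def by blast
      then have "s \<inter> {..<n} = s" "insert n s \<inter> {..<n} = s"
        by auto
      with no have "\<not> E (Suc n) s" "\<not> E (Suc n) (insert n s)"
        by blast+
      then obtain M1 M2 where M: "M1 \<ge> Suc n" "M2 \<ge> Suc n"
        and no1: "\<And>t. Q M1 t \<Longrightarrow> t \<inter> {..<Suc n} \<noteq> s"
        and no2: "\<And>t. Q M2 t \<Longrightarrow> t \<inter> {..<Suc n} \<noteq> insert n s"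
        unfolding E_def by blast
      have "n \<le> max M1 M2"
        using M by simp
      then obtain t where t: "Q (max M1 M2) t" "t \<inter> {..<n} = s"
        using E unfolding E_def by blast
      have "t \<inter> {..<M1} \<inter> {..<Suc n} = t \<inter> {..<Suc n}"
        "t \<inter> {..<M2} \<inter> {..<Suc n} = t \<inter> {..<Suc n}"
        using M by auto
      moreover have "t \<inter> {..<M1} \<inter> {..<Suc n} \<noteq> s"
        by (rule no1[OF restrict[OF t(1)]]) simp
      moreover have "t \<inter> {..<M2} \<inter> {..<Suc n} \<noteq> insert n s"
        by (rule no2[OF restrict[OF t(1)]]) simp
      ultimately have "t \<inter> {..<Suc n} \<noteq> s" "t \<inter> {..<Suc n} \<noteq> insert n s"
        by simp_all
      then show False
        unfolding lessThan_Suc t(2)[symmetric] by blast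
    qed
  qed
  then obtain f where E: "\<And>n. E n (f n)" and f: "\<And>n. f (Suc n) \<inter> {..<n} = f n"
    by blast
  have "Q N (f N)" and sub: "f N \<subseteq> {..<N}" for N
  proof -
    obtain t where "Q N t" "t \<inter> {..<N} = f N"
      using E[of N] unfolding E_def by blast
    then show "Q N (f N)" "f N \<subseteq> {..<N}"
      using restrict[of N t N] by auto
  qed
  moreover have coherent: "f m \<inter> {..<n} = f n" if "n \<le> m" for m n
    using that
  proof (induction m rule: nat_induct_at_least)
    case base
    show ?case using sub[of n] by blast
  next
    case (Suc m)
    have "f (Suc m) \<inter> {..<n} = f (Suc m) \<inter> {..<m} \<inter> {..<n}"
      using Suc.hyps by auto
    also have "\<dots> = f n"
      unfolding f by (rule Suc.IH)
    finally show ?case .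
  qed
  have "{n. n \<in> f (Suc n)} \<inter> {..<N} = f N" for N
  proof -
    have "n \<in> f (Suc n) \<longleftrightarrow> n \<in> f N" if "n < N" for n
      unfolding coherent[OF Suc_leI[OF that], symmetric] by simp
    then show ?thesis
      using sub[of N] by auto
  qed
  ultimately show ?thesis
    by (intro exI[of _ "{n. n \<in> f (Suc n)}"]) simp
qed

lemma ex_subset_lessThan_iff_set_decode:
  "(\<exists>T\<subseteq>{..<N}. Q T) \<longleftrightarrow> (\<exists>t<2 ^ N. Q (set_decode t))"
proof
  assume "\<exists>T\<subseteq>{..<N}. Q T"
  then obtain T where T: "T \<subseteq> {..<N}" "Q T"
    by blast
  then have "finite T"
    using finite_subset by blast
  have "set_encode T \<le> (\<Sum>i\<in>{..<N}. 2 ^ i)"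
    unfolding set_encode_def using T(1) by (intro sum_mono2) auto
  also have "\<dots> < 2 ^ N"
    using sum_power2[of N] by (simp add: atLeast0LessThan)
  finally show "\<exists>t<2 ^ N. Q (set_decode t)"
    using T(2) \<open>finite T\<close> by (intro exI[of _ "set_encode T"]) simp
next
  assume "\<exists>t<2 ^ N. Q (set_decode t)"
  then obtain t where t: "t < 2 ^ N" "Q (set_decode t)"
    by blast
  have "n < N" if "n \<in> set_decode t" for n
  proof (rule ccontr)
    assume "\<not> n < N"
    then have "(2 :: nat) ^ N \<le> 2 ^ n"
      by (intro power_increasing) simp_all
    then have "t < 2 ^ n"
      using t(1) by linarith
    then show False
      using that by (simp add: set_decode_def)
  qed
  then show "\<exists>T\<subseteq>{..<N}. Q T"
    using t(2) by blast
qed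

lemma mem_set_decode_less: "n \<in> set_decode m \<Longrightarrow> n < m"
proof (rule ccontr)
  assume "n \<in> set_decode m" "\<not> n < m"
  then have "m < 2 ^ n"
    using less_exp[of n] by linarith
  with \<open>n \<in> set_decode m\<close> show False
    by (simp add: set_decode_def)
qed

section \<open>Words and their codes\<close>

context group
begin

lemma word_value_Nil [simp]: "word_value G [] = \<one>"
  by (simp add: word_value_def)

lemma word_value_Cons [simp]: "word_value G (s # w) = s \<otimes> word_value G w"
  by (simp add: word_value_def)

lemma word_value_closed [simp]: "set w \<subseteq> carrier G \<Longrightarrow> word_value G w \<in> carrier G"
  by (induction w) auto

lemma word_value_append:
  "set u \<subseteq> carrier G \<Longrightarrow> set v \<subseteq> carrier G \<Longrightarrow>
    word_value G (u @ v) = word_value G u \<otimes> word_value G v"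
  by (induction u) (auto simp: m_assoc)

lemma symmetric_generating_set_word:
  assumes "symmetric_generating_set G S" and "g \<in> carrier G"
  obtains w where "w \<in> lists S" and "word_value G w = g"
proof -
  have S: "S \<subseteq> carrier G" "\<And>s. s \<in> S \<Longrightarrow> inv s \<in> S"
    using assms(1) unfolding symmetric_generating_set_def by auto
  have "g \<in> generate G S"
    using assms unfolding symmetric_generating_set_def by simp
  then have "\<exists>w\<in>lists S. word_value G w = g"
  proof induction
    case one
    show ?case by (intro bexI[of _ "[]"]) auto
  next
    case (incl h)
    then show ?case using S by (intro bexI[of _ "[h]"]) auto
  next
    case (inv h)
    then show ?case using S by (intro bexI[of _ "[inv h]"]) auto
  next
    case (eng h1 h2)
    then obtain u v where "u \<in> lists S" "word_value G u = h1" "v \<in> lists S" "word_value G v = h2"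
      by blast
    then show ?case
      using S(1) by (intro bexI[of _ "u @ v"]) (auto simp: word_value_append in_listsD subset_iff)
  qed
  then show thesis
    using that by blast
qed

end

text \<open>Numbers that code no letter stand for the identity. In this way every number is the code of a
  word with a value in the group, and the words that name places need no well-formedness condition.\<close>

definition letter_of_code :: "('a, 'm) monoid_scheme \<Rightarrow> 'a set \<Rightarrow> ('a \<Rightarrow> nat) \<Rightarrow> nat \<Rightarrow> 'a" where
  "letter_of_code G S e n = (if n \<in> e ` S then inv_into S e n else \<one>\<^bsub>G\<^esub>)"

definition code_value :: "('a, 'm) monoid_scheme \<Rightarrow> 'a set \<Rightarrow> ('a \<Rightarrow> nat) \<Rightarrow> nat \<Rightarrow> 'a" where
  "code_value G S e n = word_value G (map (letter_of_code G S e) (list_decode n))"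

definition word_code :: "('a \<Rightarrow> nat) \<Rightarrow> 'a list \<Rightarrow> nat" where
  "word_code e w = list_encode (map e w)"

lemma word_code_Nil [simp]: "word_code e [] = 0"
  by (simp add: word_code_def)

lemma word_code_Cons: "word_code e (s # w) = Suc (prod_encode (e s, word_code e w))"
  by (simp add: word_code_def)

lemma word_code_append: "word_code e (u @ v) = append_code (word_code e u) (word_code e v)"
  by (simp add: word_code_def append_code_def)

lemma append_code_0 [simp]: "append_code n 0 = n" "append_code 0 n = n"
  by (simp_all add: append_code_def)

lemma word_code_inject:
  assumes "inj_on e S" "u \<in> lists S" "v \<in> lists S"
  shows "word_code e u = word_code e v \<longleftrightarrow> u = v"
proof -
  have "inj_on e (set u \<union> set v)"
    using assms by (auto intro: inj_on_subset)
  then show ?thesis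
    using map_inj_on[of e u v] by (auto simp: word_code_def list_encode_eq)
qed

lemma word_code_range_iff:
  "n \<in> word_code e ` lists S \<longleftrightarrow> (\<forall>i<length_code n. nth_code n i \<in> e ` S)"
proof -
  have "nth_code n i = list_decode n ! i" if "i < length (list_decode n)" for i
    using nth_code[OF that] by simp
  then have "(\<forall>i<length_code n. nth_code n i \<in> e ` S) \<longleftrightarrow> list_decode n \<in> lists (e ` S)"
    by (simp add: length_code_def in_lists_conv_set all_set_conv_all_nth)
  also have "\<dots> \<longleftrightarrow> list_decode n \<in> map e ` lists S"
    by (simp add: lists_image)
  also have "\<dots> \<longleftrightarrow> n \<in> word_code e ` lists S"
  proof
    assume "list_decode n \<in> map e ` lists S"
    then obtain w where "w \<in> lists S" "list_decode n = map e w"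
      by blast
    then show "n \<in> word_code e ` lists S"
      using list_decode_inverse[of n] by (auto simp: word_code_def)
  qed (auto simp: word_code_def)
  finally show ?thesis
    by blast
qed

context group
begin

lemma code_value_closed [simp]: "S \<subseteq> carrier G \<Longrightarrow> code_value G S e n \<in> carrier G"
  unfolding code_value_def
  by (intro word_value_closed) (auto simp: letter_of_code_def inv_into_into subset_iff)

lemma code_value_append:
  assumes "S \<subseteq> carrier G"
  shows "code_value G S e (append_code m n) = code_value G S e m \<otimes> code_value G S e n"
proof -
  have "set (map (letter_of_code G S e) l) \<subseteq> carrier G" for l
    using assms by (auto simp: letter_of_code_def inv_into_into subset_iff)
  then show ?thesis
    unfolding code_value_def append_code_def by (simp add: word_value_append)
qed

lemma code_value_word_code:
  assumes "inj_on e S" "w \<in> lists S"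
  shows "code_value G S e (word_code e w) = word_value G w"
proof -
  have "letter_of_code G S e (e s) = s" if "s \<in> S" for s
    using assms(1) that by (simp add: letter_of_code_def)
  then have "map (letter_of_code G S e) (map e w) = w"
    unfolding map_map using assms(2) by (intro map_idI) auto
  then show ?thesis
    by (simp add: code_value_def word_code_def)
qed

lemma code_value_Suc:
  assumes "inj_on e S" "s \<in> S"
  shows "code_value G S e (Suc (prod_encode (e s, n))) = s \<otimes> code_value G S e n"
  using assms by (simp add: code_value_def letter_of_code_def)

end

section \<open>Subshifts and sliding block codes\<close>

lemma avoiding_iff:
  "x \<in> avoiding G A C \<longleftrightarrow> x \<in> configs G A \<and>
     (\<forall>g\<in>carrier G. \<forall>c\<in>C. \<exists>(w, a)\<in>c. x (g \<otimes>\<^bsub>G\<^esub> word_value G w) \<noteq> a)"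
  unfolding avoiding_def cylinder_def by (auto simp: case_prod_unfold)

lemma topspace_config [simp]: "topspace (config_topology G A) = configs G A"
  by (simp add: config_topology_def configs_def)

text \<open>Basic neighbourhoods in the product topology restrict finitely many coordinates only.\<close>

lemma config_open_contains_cylinder:
  assumes "openin (config_topology G A) V" "x \<in> V"
  obtains F where "finite F" "F \<subseteq> carrier G"
    "\<And>z. z \<in> configs G A \<Longrightarrow> (\<And>f. f \<in> F \<Longrightarrow> z f = x f) \<Longrightarrow> z \<in> V"
proof -
  obtain U where U: "finite {i \<in> carrier G. U i \<noteq> A}" "x \<in> PiE (carrier G) U" "PiE (carrier G) U \<subseteq> V"
    using assms unfolding config_topology_def openin_product_topology_alt by auto
  have "z \<in> PiE (carrier G) U" if "z \<in> configs G A"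
    and "\<And>f. f \<in> {i \<in> carrier G. U i \<noteq> A} \<Longrightarrow> z f = x f" for z
  proof (rule PiE_I)
    fix i
    assume "i \<in> carrier G"
    then show "z i \<in> U i"
      using that U(2) by (cases "U i = A") (auto simp: configs_def PiE_iff)
  qed (use that(1) in \<open>auto simp: configs_def PiE_iff extensional_def\<close>)
  then show thesis
    using that[of "{i \<in> carrier G. U i \<noteq> A}"] U by blast
qed

lemma openin_config_cylinder:
  assumes "finite F" "F \<subseteq> carrier G"
  shows "openin (config_topology G A) {z \<in> configs G A. \<forall>f\<in>F. z f = x f}"
proof -
  let ?U = "\<lambda>i. {a \<in> A. i \<in> F \<longrightarrow> a = x i}"
  have eq: "{z \<in> configs G A. \<forall>f\<in>F. z f = x f} = PiE (carrier G) ?U"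
    using assms(2) by (auto simp: configs_def PiE_iff extensional_def)
  have "finite {i \<in> carrier G. ?U i \<noteq> A}"
    by (rule finite_subset[OF _ assms(1)]) auto
  then show ?thesis
    unfolding eq config_topology_def by (subst openin_PiE_gen) auto
qed

context group
begin

text \<open>The Curtis-Hedlund-Lyndon theorem. Each configuration has a cylinder neighbourhood on which the
  symbol of the image at the identity is constant; by compactness finitely many such cylinders cover
  \<open>X\<close>, and the window is the union of their finite supports.\<close>

lemma factor_map_finite_window:
  assumes "finite A" "closedin (config_topology G A) X" "factor_map G A X B Y \<phi>"
  obtains F where "finite F" "F \<subseteq> carrier G"
    "\<And>x z. x \<in> X \<Longrightarrow> z \<in> X \<Longrightarrow> \<forall>f\<in>F. x f = z f \<Longrightarrow> \<phi> x \<one> = \<phi> z \<one>"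
proof -
  have X: "X \<subseteq> configs G A"
    using closedin_subset[OF assms(2)] by simp
  have "compact_space (config_topology G A)"
    unfolding config_topology_def compact_space_product_topology
    using assms(1) by (simp add: compact_space_discrete_topology)
  then have compact: "compactin (config_topology G A) X"
    using closedin_compact_space assms(2) by blast
  have "continuous_map (subtopology (config_topology G A) X) (config_topology G B) \<phi>"
    using assms(3) unfolding factor_map_def continuous_map_in_subtopology by blast
  then have cont: "continuous_map (subtopology (config_topology G A) X) (discrete_topology B) (\<lambda>x. \<phi> x \<one>)"
    unfolding config_topology_def by (rule continuous_map_componentwise[THEN iffD1, THEN conjunct2, rule_format]) simp
  have "\<exists>F. finite F \<and> F \<subseteq> carrier G \<and>
      (\<forall>z\<in>X. (\<forall>f\<in>F. z f = x f) \<longrightarrow> \<phi> z \<one> = \<phi> x \<one>)" if x: "x \<in> X" for x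
  proof -
    have "\<phi> x \<one> \<in> B"
      using cont x X unfolding continuous_map_def by auto
    then have "openin (subtopology (config_topology G A) X)
        {z \<in> topspace (subtopology (config_topology G A) X). \<phi> z \<one> \<in> {\<phi> x \<one>}}"
      by (intro openin_continuous_map_preimage[OF cont]) simp
    then obtain V where V: "openin (config_topology G A) V"
      "{z \<in> topspace (subtopology (config_topology G A) X). \<phi> z \<one> \<in> {\<phi> x \<one>}} = V \<inter> X"
      unfolding openin_subtopology by blast
    with x X have "x \<in> V"
      by auto
    then obtain F where F: "finite F" "F \<subseteq> carrier G"
      "\<And>z. z \<in> configs G A \<Longrightarrow> (\<And>f. f \<in> F \<Longrightarrow> z f = x f) \<Longrightarrow> z \<in> V"
      by (rule config_open_contains_cylinder[OF V(1)]) blast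
    have "\<phi> z \<one> = \<phi> x \<one>" if "z \<in> X" "\<forall>f\<in>F. z f = x f" for z
      using V(2) F(3)[of z] that X by auto
    then show ?thesis
      using F by blast
  qed
  then have "\<forall>x\<in>X. \<exists>F. finite F \<and> F \<subseteq> carrier G \<and>
      (\<forall>z\<in>X. (\<forall>f\<in>F. z f = x f) \<longrightarrow> \<phi> z \<one> = \<phi> x \<one>)"
    by blast
  from bchoice[OF this] obtain F where "\<forall>x\<in>X. finite (F x) \<and> F x \<subseteq> carrier G \<and>
      (\<forall>z\<in>X. (\<forall>f\<in>F x. z f = x f) \<longrightarrow> \<phi> z \<one> = \<phi> x \<one>)"
    by blast
  then have F: "\<And>x. x \<in> X \<Longrightarrow> finite (F x)" "\<And>x. x \<in> X \<Longrightarrow> F x \<subseteq> carrier G"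
    "\<And>x z. x \<in> X \<Longrightarrow> z \<in> X \<Longrightarrow> (\<forall>f\<in>F x. z f = x f) \<Longrightarrow> \<phi> z \<one> = \<phi> x \<one>"
    by blast+
  let ?U = "\<lambda>x. {z \<in> configs G A. \<forall>f\<in>F x. z f = x f}"
  have "\<exists>\<F>. finite \<F> \<and> \<F> \<subseteq> ?U ` X \<and> X \<subseteq> \<Union>\<F>"
  proof (rule compactinD[OF compact])
    show "openin (config_topology G A) U" if "U \<in> ?U ` X" for U
      using that F(1,2) by (auto intro: openin_config_cylinder)
    show "X \<subseteq> \<Union>(?U ` X)"
      using X by blast
  qed
  then obtain \<F> where \<F>: "finite \<F>" "\<F> \<subseteq> ?U ` X" "X \<subseteq> \<Union>\<F>"
    by blast
  then obtain K where K: "K \<subseteq> X" "finite K" "\<F> = ?U ` K"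
    using finite_subset_image[OF \<F>(1,2)] by blast
  show thesis
  proof (rule that[of "\<Union>(F ` K)"])
    show "finite (\<Union>(F ` K))" "\<Union>(F ` K) \<subseteq> carrier G"
      using K F(1,2) by auto
    fix x z
    assume xz: "x \<in> X" "z \<in> X" "\<forall>f\<in>\<Union>(F ` K). x f = z f"
    then obtain k where k: "k \<in> K" "\<forall>f\<in>F k. x f = k f"
      using K(3) \<F>(3) by blast
    then have "\<forall>f\<in>F k. z f = k f"
      using xz(3) by (metis UN_I)
    then show "\<phi> x \<one> = \<phi> z \<one>"
      using F(3)[of k x] F(3)[of k z] k K(1) xz(1,2) by auto
  qed
qed

end

text \<open>The codings that no configuration of \<open>Y\<close> matches at the identity. For a shift-invariant \<open>Y\<close> these
  are the codings that no configuration of \<open>Y\<close> matches anywhere.\<close>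

definition forbidden_codings ::
  "('a, 'm) monoid_scheme \<Rightarrow> 'a set \<Rightarrow> 'b set \<Rightarrow> ('a \<Rightarrow> 'b) set \<Rightarrow> ('a, 'b) pattern_coding set" where
  "forbidden_codings G S A Y =
     {c \<in> pattern_codings S A. \<forall>y\<in>Y. \<exists>(w, a)\<in>c. y (word_value G w) \<noteq> a}"

text \<open>A configuration outside the closed set \<open>Y\<close> has a cylinder neighbourhood disjoint from \<open>Y\<close>, and a
  cylinder is a coding matched at the identity once its places are spelled as words.\<close>

lemma (in group) avoiding_forbidden_codings:
  assumes "symmetric_generating_set G S" "subshift G A Y"
  shows "avoiding G A (forbidden_codings G S A Y) = Y"
proof
  have Y: "Y \<subseteq> configs G A"
    using assms(2) closedin_subset unfolding subshift_def by fastforce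
  have S: "S \<subseteq> carrier G"
    using assms(1) unfolding symmetric_generating_set_def by blast
  show "avoiding G A (forbidden_codings G S A Y) \<subseteq> Y"
  proof
    fix y
    assume y: "y \<in> avoiding G A (forbidden_codings G S A Y)"
    show "y \<in> Y"
    proof (rule ccontr)
      assume "y \<notin> Y"
      then have V: "y \<in> configs G A - Y" "openin (config_topology G A) (configs G A - Y)"
        using y assms(2) by (auto simp: avoiding_iff subshift_def closedin_def)
      obtain F where F: "finite F" "F \<subseteq> carrier G"
        "\<And>z. z \<in> configs G A \<Longrightarrow> (\<And>f. f \<in> F \<Longrightarrow> z f = y f) \<Longrightarrow> z \<in> configs G A - Y"
        by (rule config_open_contains_cylinder[OF V(2,1)]) blast
      have "\<forall>g\<in>carrier G. \<exists>w. w \<in> lists S \<and> word_value G w = g"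
        using symmetric_generating_set_word[OF assms(1)] by blast
      from bchoice[OF this] obtain w where w: "\<And>g. g \<in> carrier G \<Longrightarrow> w g \<in> lists S"
        "\<And>g. g \<in> carrier G \<Longrightarrow> word_value G (w g) = g"
        by blast
      let ?c = "(\<lambda>f. (w f, y f)) ` F"
      have "?c \<in> forbidden_codings G S A Y"
      proof -
        have "\<exists>f\<in>F. z f \<noteq> y f" if "z \<in> Y" for z
          using F(3)[of z] that Y by blast
        then have "\<forall>z\<in>Y. \<exists>(v, a)\<in>?c. z (word_value G v) \<noteq> a"
          using F(2) w(2) by (simp add: subset_iff)
        moreover have "?c \<subseteq> lists S \<times> A"
        proof
          fix q
          assume "q \<in> ?c"
          then obtain f where "q = (w f, y f)" "f \<in> carrier G"
            using F(2) by blast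
          then show "q \<in> lists S \<times> A"
            using w(1) V(1) by (auto simp: configs_def)
        qed
        ultimately show ?thesis
          using F(1) by (simp add: forbidden_codings_def pattern_codings_def)
      qed
      then have "\<exists>(v, a)\<in>?c. y (\<one> \<otimes> word_value G v) \<noteq> a"
        using y unfolding avoiding_iff by blast
      then show False
        using F(2) w(2) by (simp add: subset_iff)
    qed
  qed
  show "Y \<subseteq> avoiding G A (forbidden_codings G S A Y)"
  proof
    fix y
    assume y: "y \<in> Y"
    have "\<exists>(w, a)\<in>c. y (g \<otimes> word_value G w) \<noteq> a"
      if g: "g \<in> carrier G" and c: "c \<in> forbidden_codings G S A Y" for g c
    proof -
      have "shift G (inv g) y \<in> Y"
        using y g assms(2) unfolding subshift_def by simp
      then obtain w a where wa: "(w, a) \<in> c" "shift G (inv g) y (word_value G w) \<noteq> a"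
        using c unfolding forbidden_codings_def by blast
      then have "set w \<subseteq> S"
        using c unfolding forbidden_codings_def pattern_codings_def by auto
      then have "word_value G w \<in> carrier G"
        using S by (intro word_value_closed) blast
      then show ?thesis
        using wa g by (auto simp: shift_def)
    qed
    then show "y \<in> avoiding G A (forbidden_codings G S A Y)"
      using y Y unfolding avoiding_iff by blast
  qed
qed

section \<open>Refuting the existence of a preimage\<close>

definition coding_atoms :: "('a \<Rightarrow> nat) \<Rightarrow> ('b \<Rightarrow> nat) \<Rightarrow> ('a, 'b) pattern_coding \<Rightarrow> nat set" where
  "coding_atoms e d c = (\<lambda>(w, a). prod_encode (word_code e w, d a)) ` c"

lemma encode_coding_eq: "encode_coding e d c = set_encode (coding_atoms e d c)"
  by (simp add: encode_coding_def coding_atoms_def word_code_def)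

lemma set_decode_encode_coding:
  "c \<in> pattern_codings S A \<Longrightarrow> set_decode (encode_coding e d c) = coding_atoms e d c"
  by (simp add: encode_coding_eq pattern_codings_def coding_atoms_def)

lemma encode_coding_range_iff:
  assumes "inj_on e S" "inj_on d A"
  shows "m \<in> encode_coding e d ` pattern_codings S A \<longleftrightarrow>
    (\<forall>n\<in>set_decode m. \<exists>u\<in>word_code e ` lists S. \<exists>a\<in>d ` A. n = prod_encode (u, a))"
    (is "?L \<longleftrightarrow> ?R")
proof
  assume ?L
  then obtain c where c: "c \<in> pattern_codings S A" "m = encode_coding e d c"
    by blast
  then have "set_decode m = coding_atoms e d c"
    by (simp add: set_decode_encode_coding)
  moreover have "u \<in> lists S \<and> a \<in> A" if "(u, a) \<in> c" for u a
    using that c(1) unfolding pattern_codings_def by blast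
  ultimately show ?R
    unfolding coding_atoms_def by force
next
  assume R: ?R
  let ?c = "{(w, a) \<in> lists S \<times> A. prod_encode (word_code e w, d a) \<in> set_decode m}"
  have atoms: "coding_atoms e d ?c = set_decode m"
  proof
    show "set_decode m \<subseteq> coding_atoms e d ?c"
    proof
      fix n
      assume n: "n \<in> set_decode m"
      then obtain w a where "w \<in> lists S" "a \<in> A" "n = prod_encode (word_code e w, d a)"
        using R by blast
      with n show "n \<in> coding_atoms e d ?c"
        unfolding coding_atoms_def by (intro image_eqI[of _ _ "(w, a)"]) auto
    qed
  qed (auto simp: coding_atoms_def)
  have "inj_on (\<lambda>(w, a). prod_encode (word_code e w, d a)) ?c"
  proof (rule inj_onI)
    fix p q
    assume "p \<in> ?c" "q \<in> ?c"
      and eq: "(\<lambda>(w, a). prod_encode (word_code e w, d a)) p = (\<lambda>(w, a). prod_encode (word_code e w, d a)) q"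
    then obtain w a v b where "p = (w, a)" "q = (v, b)" "w \<in> lists S" "a \<in> A" "v \<in> lists S" "b \<in> A"
      by blast
    with eq show "p = q"
      using word_code_inject[OF assms(1), of w v] inj_on_eq_iff[OF assms(2), of a b] by auto
  qed
  moreover have "finite (coding_atoms e d ?c)"
    unfolding atoms by (rule finite_set_decode)
  ultimately have "finite ?c"
    unfolding coding_atoms_def by (rule finite_imageD[rotated])
  then have "?c \<in> pattern_codings S A"
    by (auto simp: pattern_codings_def)
  moreover have "encode_coding e d ?c = m"
    unfolding encode_coding_eq atoms by (rule set_decode_inverse)
  ultimately show ?L
    by (intro image_eqI[OF HOL.sym])
qed

lemma encode_coding_image_iff:
  assumes "K \<subseteq> pattern_codings S A"
    and "\<And>c. c \<in> pattern_codings S A \<Longrightarrow> c \<in> K \<longleftrightarrow> Q (encode_coding e d c)"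
  shows "m \<in> encode_coding e d ` K \<longleftrightarrow> m \<in> encode_coding e d ` pattern_codings S A \<and> Q m"
  using assms by blast

text \<open>The data of the problem: \<open>\<langle>T | R\<rangle>\<close> is a presentation of \<open>G\<close>, while configurations and codings
  are written with the generators \<open>S\<close>; letters are numbered by \<open>e\<close>, \<open>e'\<close>, \<open>d\<close> and \<open>d'\<close>; the
  factor map goes from the subshift that avoids \<open>C\<close> onto \<open>Y\<close> and has the finite window \<open>F\<close>.\<close>

locale coded_factor = group G for G :: "('a, 'm) monoid_scheme" (structure) +
  fixes S T :: "'a set" and R :: "'a list set" and e e' :: "'a \<Rightarrow> nat"
    and A :: "'b set" and d :: "'b \<Rightarrow> nat" and C :: "('a, 'b) pattern_coding set"
    and B :: "'c set" and d' :: "'c \<Rightarrow> nat" and Y :: "('a \<Rightarrow> 'c) set"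
    and \<phi> :: "('a \<Rightarrow> 'b) \<Rightarrow> ('a \<Rightarrow> 'c)" and F :: "'a set"
  assumes generators: "symmetric_generating_set G S" and presentation: "presentation G T R"
    and e: "inj_on e S" and e': "inj_on e' T"
    and A: "finite A" and d: "inj_on d A" and B: "finite B" and d': "inj_on d' B"
    and C: "C \<subseteq> pattern_codings S A"
    and shift_invariant: "\<And>g x. g \<in> carrier G \<Longrightarrow> x \<in> avoiding G A C \<Longrightarrow> shift G g x \<in> avoiding G A C"
    and equivariant: "\<And>g x. g \<in> carrier G \<Longrightarrow> x \<in> avoiding G A C \<Longrightarrow> \<phi> (shift G g x) = shift G g (\<phi> x)"
    and surjective: "\<phi> ` avoiding G A C = Y"
    and F: "finite F" "F \<subseteq> carrier G"
    and window: "\<And>x z. x \<in> avoiding G A C \<Longrightarrow> z \<in> avoiding G A C \<Longrightarrow>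
      \<forall>f\<in>F. x f = z f \<Longrightarrow> \<phi> x \<one> = \<phi> z \<one>"
begin

lemma S_subset: "S \<subseteq> carrier G" and T_subset: "T \<subseteq> carrier G"
  and finite_S: "finite S" and finite_T: "finite T" and T_inv: "s \<in> T \<Longrightarrow> inv s \<in> T"
  and R_subset: "R \<subseteq> lists T"
  using generators presentation
  unfolding presentation_def symmetric_generating_set_def by auto

lemma word_value_eq_iff_presented_eq:
  "u \<in> lists T \<Longrightarrow> v \<in> lists T \<Longrightarrow> word_value G u = word_value G v \<longleftrightarrow> presented_eq G T R u v"
  using presentation unfolding presentation_def by blast

definition S_word :: "'a \<Rightarrow> 'a list" where
  "S_word g = (SOME w. w \<in> lists S \<and> word_value G w = g)"

definition T_word :: "'a \<Rightarrow> 'a list" where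
  "T_word g = (SOME w. w \<in> lists T \<and> word_value G w = g)"

lemma S_word:
  assumes "g \<in> carrier G"
  shows "S_word g \<in> lists S" "word_value G (S_word g) = g"
proof -
  have "\<exists>w. w \<in> lists S \<and> word_value G w = g"
    using symmetric_generating_set_word[OF generators assms] by blast
  then have "S_word g \<in> lists S \<and> word_value G (S_word g) = g"
    unfolding S_word_def by (rule someI_ex)
  then show "S_word g \<in> lists S" "word_value G (S_word g) = g"
    by simp_all
qed

lemma T_word:
  assumes "g \<in> carrier G"
  shows "T_word g \<in> lists T" "word_value G (T_word g) = g"
proof -
  have "symmetric_generating_set G T"
    using presentation unfolding presentation_def by blast
  then have "\<exists>w. w \<in> lists T \<and> word_value G w = g"
    using symmetric_generating_set_word[OF _ assms] by blast
  then have "T_word g \<in> lists T \<and> word_value G (T_word g) = g"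
    unfolding T_word_def by (rule someI_ex)
  then show "T_word g \<in> lists T" "word_value G (T_word g) = g"
    by simp_all
qed

lemma S_words_closed [simp]: "w \<in> lists S \<Longrightarrow> word_value G w \<in> carrier G"
  using S_subset by (intro word_value_closed) auto

lemma T_words_closed [simp]: "w \<in> lists T \<Longrightarrow> word_value G w \<in> carrier G"
  using T_subset by (intro word_value_closed) auto

abbreviation S_value :: "nat \<Rightarrow> 'a" where "S_value \<equiv> code_value G S e"
abbreviation T_value :: "nat \<Rightarrow> 'a" where "T_value \<equiv> code_value G T e'"

text \<open>The atom saying that a configuration has the letter with number \<open>\<alpha>\<close> at the group element
  \<open>T_value u \<otimes> S_value w\<close>. The prefix \<open>u\<close>, in generators of the presentation, is where relators are
  inserted; the suffix \<open>w\<close>, in generators of \<open>S\<close>, is the word of a pattern coding. With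
  both at hand, the places of a translated coding need no words over a mixed alphabet.\<close>

definition place :: "nat \<Rightarrow> nat \<Rightarrow> nat \<Rightarrow> nat" where
  "place u w \<alpha> = prod_encode (prod_encode (u, w), \<alpha>)"

lemma place_eq_iff [simp]: "place u w \<alpha> = place u' w' \<alpha>' \<longleftrightarrow> u = u' \<and> w = w' \<and> \<alpha> = \<alpha>'"
  by (simp add: place_def)

text \<open>Free cancellation is treated as the insertion of a relator. The empty word is included so that
  the clause for relators also says that a place has at most one letter.\<close>

definition relator_codes :: "nat set" where
  "relator_codes = insert 0 (word_code e' ` R \<union> (\<lambda>s. word_code e' [s, inv s]) ` T)"

text \<open>The pairs that the local rule of \<open>\<phi>\<close> excludes: no configuration that shows the window content
  \<open>\<beta>\<close> has an image with the symbol \<open>b\<close> at the identity. Window contents that do not occur at all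
  are paired with every symbol. This finite table is all that the enumeration has to know of \<open>\<phi>\<close>.\<close>

definition bad_windows :: "(('a \<Rightarrow> 'b) \<times> 'c) set" where
  "bad_windows = {(\<beta>, b) \<in> (F \<rightarrow>\<^sub>E A) \<times> B.
     \<forall>x\<in>avoiding G A C. (\<forall>f\<in>F. x f = \<beta> f) \<longrightarrow> \<phi> x \<one> \<noteq> b}"

lemma finite_bad_windows: "finite bad_windows"
proof (rule finite_subset)
  show "bad_windows \<subseteq> (F \<rightarrow>\<^sub>E A) \<times> B"
    unfolding bad_windows_def by blast
qed (simp add: finite_PiE F A B)

text \<open>A set \<open>I\<close> of atoms, read as a partial description of a configuration, contradicts the requirement
  that the configuration belongs to the subshift and that its image matches \<open>p\<close>. All four kinds of
  contradiction are positive in \<open>I\<close> and involve finitely many atoms.\<close>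

inductive clash :: "('a, 'c) pattern_coding \<Rightarrow> nat set \<Rightarrow> bool" for p I where
  relator: "r \<in> relator_codes \<Longrightarrow> \<alpha> \<in> d ` A \<Longrightarrow> \<beta> \<in> d ` A - {\<alpha>} \<Longrightarrow>
    place (append_code u (append_code r v)) w \<alpha> \<in> I \<Longrightarrow> place (append_code u v) w \<beta> \<in> I \<Longrightarrow> clash p I"
| letter: "s \<in> S \<Longrightarrow> \<alpha> \<in> d ` A \<Longrightarrow> \<beta> \<in> d ` A - {\<alpha>} \<Longrightarrow>
    place u (Suc (prod_encode (e s, w))) \<alpha> \<in> I \<Longrightarrow>
    place (append_code u (word_code e' (T_word s))) w \<beta> \<in> I \<Longrightarrow> clash p I"
| coding: "c \<in> C \<Longrightarrow> \<forall>(w, a)\<in>c. place u (word_code e w) (d a) \<in> I \<Longrightarrow> clash p I"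
| image: "(\<beta>, b) \<in> bad_windows \<Longrightarrow> (w, b) \<in> p \<Longrightarrow>
    \<forall>f\<in>F. place 0 (append_code (word_code e w) (word_code e (S_word f))) (d (\<beta> f)) \<in> I \<Longrightarrow>
    clash p I"

text \<open>The set \<open>I\<close> is meant to contain exactly the true atoms below \<open>N\<close>. The bound in the second clause
  ensures that a place counts as empty only if all of its atoms had the chance to be in \<open>I\<close>.\<close>

definition refuted :: "('a, 'c) pattern_coding \<Rightarrow> nat \<Rightarrow> nat set \<Rightarrow> bool" where
  "refuted p N I \<longleftrightarrow> clash p I \<or>
     (\<exists>u w. \<forall>\<alpha>\<in>d ` A. place u w \<alpha> < N \<and> place u w \<alpha> \<notin> I)"

lemma clash_mono:
  assumes "clash p I" "I \<subseteq> J"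
  shows "clash p J"
  using assms(1)
proof cases
  case relator
  then show ?thesis using assms(2) by (intro clash.relator) auto
next
  case letter
  then show ?thesis using assms(2) by (intro clash.letter) auto
next
  case coding
  then show ?thesis using assms(2) by (intro clash.coding) auto
next
  case image
  then show ?thesis using assms(2) by (intro clash.image) auto
qed

lemma refuted_restrict:
  assumes "\<not> refuted p N I" "M \<le> N"
  shows "\<not> refuted p M (I \<inter> {..<M})"
proof
  assume "refuted p M (I \<inter> {..<M})"
  then consider "clash p (I \<inter> {..<M})"
    | u w where "\<forall>\<alpha>\<in>d ` A. place u w \<alpha> < M \<and> place u w \<alpha> \<notin> I \<inter> {..<M}"
    unfolding refuted_def by blast
  then show False
  proof cases
    case 1
    then show False
      using assms(1) clash_mono[of p "I \<inter> {..<M}" I] unfolding refuted_def by blast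
  next
    case 2
    then have "\<forall>\<alpha>\<in>d ` A. place u w \<alpha> < N \<and> place u w \<alpha> \<notin> I"
      using assms(2) by auto
    then show False
      using assms(1) unfolding refuted_def by blast
  qed
qed

lemma relator_value:
  assumes "r \<in> relator_codes"
  shows "T_value r = \<one>"
proof -
  have "word_value G r = \<one>" if "r \<in> R" for r
  proof -
    have "presented_eq G T R ([] @ r @ []) ([] @ [])"
      by (rule presented_eq.relator) (auto simp: that)
    moreover have "r \<in> lists T"
      using that R_subset by blast
    ultimately have "word_value G r = word_value G []"
      by (subst word_value_eq_iff_presented_eq) auto
    then show ?thesis
      by simp
  qed
  moreover have "T_value 0 = \<one>"
    using code_value_word_code[OF e', of "[]"] by simp
  moreover have "word_value G [s, inv s] = \<one>" if "s \<in> T" for s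
    using that T_subset by auto
  ultimately show ?thesis
    using assms R_subset T_inv unfolding relator_codes_def
    by (auto simp: code_value_word_code[OF e'] subset_iff simp del: word_value_Cons)
qed

text \<open>Soundness: the atoms that are true of a configuration of the subshift whose image matches \<open>p\<close>
  are not refuted, since none of the four contradictions can hold in an actual configuration.
  For the clause about the image, the configuration is shifted so that the window is read at the identity.\<close>

lemma not_refuted_of_preimage:
  assumes x: "x \<in> avoiding G A C" and p: "p \<in> pattern_codings S B"
    and p_x: "\<forall>(w, b)\<in>p. \<phi> x (word_value G w) = b"
  shows "\<not> refuted p N ({place u w (d (x (T_value u \<otimes> S_value w))) |u w. True} \<inter> {..<N})"
    (is "\<not> refuted p N (?I \<inter> _)")
proof
  have place_iff: "place u w \<alpha> \<in> ?I \<longleftrightarrow> \<alpha> = d (x (T_value u \<otimes> S_value w))" for u w \<alpha>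
    by auto
  have closed: "T_value u \<in> carrier G" "S_value w \<in> carrier G" for u w
    using T_subset S_subset by simp_all
  have x_A: "x g \<in> A" if "g \<in> carrier G" for g
    using x that by (auto simp: avoiding_iff configs_def)
  assume "refuted p N (?I \<inter> {..<N})"
  then consider "clash p ?I"
    | u w where "\<forall>\<alpha>\<in>d ` A. place u w \<alpha> < N \<and> place u w \<alpha> \<notin> ?I \<inter> {..<N}"
    unfolding refuted_def using clash_mono[of p "?I \<inter> {..<N}" ?I] by blast
  then show False
  proof cases
    case 2
    have "d (x (T_value u \<otimes> S_value w)) \<in> d ` A"
      using closed by (intro imageI x_A) simp
    moreover have "place u w (d (x (T_value u \<otimes> S_value w))) \<in> ?I"
      by blast
    ultimately show False
      using 2 by blast
  next
    case 1
    then show False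
    proof cases
      case (relator r \<alpha> \<beta> u v w)
      then show False
        unfolding place_iff
        by (simp add: code_value_append T_subset relator_value closed)
    next
      case (letter s \<alpha> \<beta> u w)
      then have "s \<in> carrier G"
        using S_subset by blast
      with letter show False
        unfolding place_iff
        by (simp add: code_value_append T_subset code_value_word_code e' T_word closed
            code_value_Suc e m_assoc)
    next
      case (coding c u)
      have "x (T_value u \<otimes> word_value G w) = a" if "(w, a) \<in> c" for w a
      proof -
        have wa: "w \<in> lists S" "a \<in> A"
          using that coding(1) C by (auto simp: pattern_codings_def)
        have "place u (word_code e w) (d a) \<in> ?I"
          using coding(2) that by blast
        then have "d a = d (x (T_value u \<otimes> word_value G w))"
          unfolding place_iff using wa by (simp add: code_value_word_code e)
        moreover have "x (T_value u \<otimes> word_value G w) \<in> A"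
          using wa closed by (intro x_A) simp
        ultimately show ?thesis
          using inj_onD[OF d] wa(2) by metis
      qed
      then have "\<forall>(w, a)\<in>c. x (T_value u \<otimes> word_value G w) = a"
        by blast
      moreover have "\<exists>(w, a)\<in>c. x (T_value u \<otimes> word_value G w) \<noteq> a"
        using x[unfolded avoiding_iff, THEN conjunct2, rule_format, OF closed(1) coding(1)] .
      ultimately show False
        by auto
    next
      case (image \<beta> b v)
      have "\<beta> \<in> F \<rightarrow>\<^sub>E A"
        using image(1) unfolding bad_windows_def by blast
      then have \<beta>: "\<beta> f \<in> A" if "f \<in> F" for f
        using that by (rule PiE_mem)
      have v: "v \<in> lists S"
        using p image(2) unfolding pattern_codings_def by blast
      let ?g = "word_value G v"
      let ?z = "shift G (inv ?g) x"
      have g: "?g \<in> carrier G"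
        using v by simp
      have z: "?z \<in> avoiding G A C"
        using g x by (intro shift_invariant) simp
      have "?z f = \<beta> f" if "f \<in> F" for f
      proof -
        have f: "f \<in> carrier G"
          using that F by blast
        have "S_value (append_code (word_code e v) (word_code e (S_word f))) = ?g \<otimes> f"
          using f v S_word[OF f] S_subset
          by (simp add: code_value_append code_value_word_code e)
        moreover have "T_value 0 = \<one>"
          by (rule relator_value) (simp add: relator_codes_def)
        ultimately have "d (\<beta> f) = d (x (?g \<otimes> f))"
          using image(3) that g f unfolding place_iff by simp
        moreover have "x (?g \<otimes> f) \<in> A"
          using g f by (intro x_A) simp
        ultimately have "x (?g \<otimes> f) = \<beta> f"
          using inj_onD[OF d] \<beta>[OF that] by metis
        then show ?thesis
          using g f by (simp add: shift_def)
      qed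
      then have "\<phi> ?z \<one> \<noteq> b"
        using image(1) z unfolding bad_windows_def by blast
      moreover have "\<phi> ?z = shift G (inv ?g) (\<phi> x)"
        using g x by (intro equivariant) simp_all
      moreover have "\<phi> x ?g = b"
        using p_x image(2) by auto
      ultimately show False
        using g by (simp add: shift_def)
    qed
  qed
qed

lemma C_finite: "c \<in> C \<Longrightarrow> finite c"
  and C_letters: "c \<in> C \<Longrightarrow> (w, a) \<in> c \<Longrightarrow> w \<in> lists S \<and> a \<in> A"
  using C unfolding pattern_codings_def by auto

text \<open>Each clause mentions finitely many atoms, hence a contradiction in an infinite set of atoms is
  already visible below some bound.\<close>

lemma clash_finite_support:
  assumes "clash p I"
  shows "\<exists>J\<subseteq>I. finite J \<and> clash p J"
  using assms
proof cases
  case (relator r \<alpha> \<beta> u v w)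
  then show ?thesis
    by (intro exI[of _ "{place (append_code u (append_code r v)) w \<alpha>, place (append_code u v) w \<beta>}"]
        conjI clash.relator[of r \<alpha> \<beta> u v w]) auto
next
  case (letter s \<alpha> \<beta> u w)
  then show ?thesis
    by (intro exI[of _ "{place u (Suc (prod_encode (e s, w))) \<alpha>,
          place (append_code u (word_code e' (T_word s))) w \<beta>}"]
        conjI clash.letter[of s \<alpha> \<beta> u w]) auto
next
  case (coding c u)
  let ?J = "(\<lambda>(w, a). place u (word_code e w) (d a)) ` c"
  have "clash p ?J"
    using coding(1) by (rule clash.coding[of _ u]) auto
  moreover have "?J \<subseteq> I" "finite ?J"
    using coding C_finite by auto
  ultimately show ?thesis
    by blast
next
  case (image \<beta> b w)
  let ?J = "(\<lambda>f. place 0 (append_code (word_code e w) (word_code e (S_word f))) (d (\<beta> f))) ` F"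
  have "clash p ?J"
    using image(1,2) by (rule clash.image) auto
  moreover have "?J \<subseteq> I" "finite ?J"
    using image(3) F(1) by auto
  ultimately show ?thesis
    by blast
qed

text \<open>Completeness: a set of atoms with no refuted restriction assigns a unique letter \<open>\<xi> u w\<close> to
  every pair of words. The letter clause moves the suffix into the prefix, and the relator clause
  shows, along a derivation in the presentation, that the letter depends only on the group element.
  The resulting configuration avoids \<open>C\<close>, and its image matches \<open>p\<close>, by the other two clauses.\<close>

lemma preimage_of_not_refuted:
  assumes p: "p \<in> pattern_codings S B" and not_refuted: "\<And>N. \<not> refuted p N (I \<inter> {..<N})"
  shows "\<exists>x\<in>avoiding G A C. \<forall>(w, b)\<in>p. \<phi> x (word_value G w) = b"
proof -
  have no_clash: "\<not> clash p I"
  proof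
    assume "clash p I"
    then obtain J where J: "J \<subseteq> I" "finite J" "clash p J"
      using clash_finite_support by blast
    then obtain N where "J \<subseteq> {..<N}"
      using finite_nat_iff_bounded by blast
    with J have "clash p (I \<inter> {..<N})"
      by (intro clash_mono[OF J(3)]) blast
    then show False
      using not_refuted unfolding refuted_def by blast
  qed
  have ex_letter: "\<exists>a. a \<in> A \<and> place u w (d a) \<in> I" for u w
  proof (rule ccontr)
    assume none: "\<nexists>a. a \<in> A \<and> place u w (d a) \<in> I"
    have "finite (place u w ` d ` A)"
      using A by simp
    then obtain N where "place u w ` d ` A \<subseteq> {..<N}"
      using finite_nat_iff_bounded by blast
    with none have "\<forall>\<alpha>\<in>d ` A. place u w \<alpha> < N \<and> place u w \<alpha> \<notin> I \<inter> {..<N}"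
      by blast
    then show False
      using not_refuted unfolding refuted_def by blast
  qed
  define \<xi> where "\<xi> u w = (SOME a. a \<in> A \<and> place u w (d a) \<in> I)" for u w
  have \<xi>: "\<xi> u w \<in> A" "place u w (d (\<xi> u w)) \<in> I" for u w
    using someI_ex[OF ex_letter[of u w]] unfolding \<xi>_def by blast+
  have relator: "\<xi> (append_code u (append_code r v)) w = \<xi> (append_code u v) w" if "r \<in> relator_codes" for r u v w
  proof (rule ccontr)
    assume "\<xi> (append_code u (append_code r v)) w \<noteq> \<xi> (append_code u v) w"
    then have neq: "d (\<xi> (append_code u (append_code r v)) w) \<noteq> d (\<xi> (append_code u v) w)"
      using inj_onD[OF d] \<xi>(1) by blast
    have "clash p I"
      by (rule clash.relator[where u = u and v = v and w = w, OF that _ _ \<xi>(2) \<xi>(2)])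
        (simp_all add: \<xi>(1) neq[symmetric])
    with no_clash show False ..
  qed
  have letter: "\<xi> u (Suc (prod_encode (e s, w))) = \<xi> (append_code u (word_code e' (T_word s))) w"
    if "s \<in> S" for s u w
  proof (rule ccontr)
    assume "\<xi> u (Suc (prod_encode (e s, w))) \<noteq> \<xi> (append_code u (word_code e' (T_word s))) w"
    then have neq: "d (\<xi> u (Suc (prod_encode (e s, w)))) \<noteq> d (\<xi> (append_code u (word_code e' (T_word s))) w)"
      using inj_onD[OF d] \<xi>(1) by blast
    have "clash p I"
      by (rule clash.letter[where u = u and w = w, OF that _ _ \<xi>(2) \<xi>(2)])
        (simp_all add: \<xi>(1) neq[symmetric])
    with no_clash show False ..
  qed
  have atom: "place u w (d a) \<in> I" if "\<xi> u w = a" for u w a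
    using \<xi>(2)[of u w] that by simp
  have presented: "\<xi> (word_code e' u) w = \<xi> (word_code e' v) w" if "presented_eq G T R u v" for u v w
    using that
  proof induction
    case (cancel u v s)
    have "word_code e' [s, inv s] \<in> relator_codes"
      using cancel by (auto simp: relator_codes_def)
    from relator[OF this, of "word_code e' u" "word_code e' v" w] show ?case
      by (simp only: word_code_append)
  next
    case (relator u v r)
    then have "word_code e' r \<in> relator_codes"
      by (auto simp: relator_codes_def)
    from \<open>\<And>w v u r. r \<in> relator_codes \<Longrightarrow> \<xi> (append_code u (append_code r v)) w = \<xi> (append_code u v) w\<close>[OF this]
    show ?case
      by (simp only: word_code_append)
  qed simp_all
  \<comment> \<open>reading \<open>w\<close> from the left, each letter is moved to the end of the prefix\<close>
  have normal_form: "\<exists>v\<in>lists T. word_value G v = word_value G u \<otimes> word_value G w \<and>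
      \<xi> (word_code e' u) (word_code e w) = \<xi> (word_code e' v) 0"
    if "u \<in> lists T" "w \<in> lists S" for u w
    using that(2,1)
  proof (induction w arbitrary: u)
    case Nil
    then show ?case
      by (intro bexI[of _ u]) simp_all
  next
    case (Cons s w)
    have s: "s \<in> carrier G"
      using Cons.hyps S_subset by blast
    have w: "w \<in> lists S"
      using Cons.hyps by blast
    have us: "u @ T_word s \<in> lists T"
      using Cons.prems T_word(1)[OF s] by simp
    have us_value: "word_value G (u @ T_word s) = word_value G u \<otimes> s"
      using Cons.prems T_word[OF s] T_subset by (subst word_value_append) auto
    obtain v where v: "v \<in> lists T"
      "word_value G v = word_value G (u @ T_word s) \<otimes> word_value G w"
      "\<xi> (word_code e' (u @ T_word s)) (word_code e w) = \<xi> (word_code e' v) 0"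
      using Cons.IH[OF us] by blast
    have "word_value G v = word_value G u \<otimes> word_value G (s # w)"
      using v(2) s w Cons.prems by (simp add: us_value m_assoc)
    moreover have "\<xi> (word_code e' u) (word_code e (s # w)) = \<xi> (word_code e' v) 0"
      using letter[OF Cons.hyps(1)] v(3) by (simp add: word_code_Cons word_code_append)
    ultimately show ?case
      using v(1) by blast
  qed
  define x where "x = (\<lambda>g\<in>carrier G. \<xi> (word_code e' (T_word g)) 0)"
  have x: "x (word_value G u \<otimes> word_value G w) = \<xi> (word_code e' u) (word_code e w)"
    if u: "u \<in> lists T" and w: "w \<in> lists S" for u w
  proof -
    obtain v where v: "v \<in> lists T" "word_value G v = word_value G u \<otimes> word_value G w"
      "\<xi> (word_code e' u) (word_code e w) = \<xi> (word_code e' v) 0"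
      using normal_form[OF u w] by blast
    have g: "word_value G u \<otimes> word_value G w \<in> carrier G"
      using u w by simp
    have "presented_eq G T R (T_word (word_value G u \<otimes> word_value G w)) v"
      using T_word[OF g] v by (subst word_value_eq_iff_presented_eq[symmetric]) simp_all
    from presented[OF this] show ?thesis
      using g v(3) by (simp add: x_def)
  qed
  have x_configs: "x \<in> configs G A"
    unfolding x_def configs_def using \<xi>(1) by simp
  have x_avoiding: "x \<in> avoiding G A C"
    unfolding avoiding_iff
  proof (intro conjI ballI x_configs, rule ccontr)
    fix g c
    assume g: "g \<in> carrier G" and c: "c \<in> C" and "\<not> (\<exists>(w, a)\<in>c. x (g \<otimes> word_value G w) \<noteq> a)"
    then have all: "x (g \<otimes> word_value G w) = a" if "(w, a) \<in> c" for w a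
      using that by auto
    have "place (word_code e' (T_word g)) (word_code e w) (d a) \<in> I" if "(w, a) \<in> c" for w a
      using x[of "T_word g" w] T_word[OF g] C_letters[OF c that] all[OF that] by (intro atom) simp
    then have "clash p I"
      by (intro clash.coding[OF c, of "word_code e' (T_word g)"]) auto
    with no_clash show False ..
  qed
  have "\<phi> x (word_value G w) = b" if wb: "(w, b) \<in> p" for w b
  proof (rule ccontr)
    assume neq: "\<phi> x (word_value G w) \<noteq> b"
    have w: "w \<in> lists S" and b: "b \<in> B"
      using wb p unfolding pattern_codings_def by blast+
    let ?g = "word_value G w"
    let ?z = "shift G (inv ?g) x"
    have g: "?g \<in> carrier G"
      using w by simp
    have z: "?z \<in> avoiding G A C"
      using g x_avoiding by (intro shift_invariant) simp_all
    have z_eq: "?z f = x (?g \<otimes> f)" if "f \<in> carrier G" for f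
      using that g by (simp add: shift_def)
    have "\<phi> ?z = shift G (inv ?g) (\<phi> x)"
      using g x_avoiding by (intro equivariant) simp_all
    then have \<phi>_z: "\<phi> ?z \<one> \<noteq> b"
      using neq g by (simp add: shift_def)
    have "(restrict ?z F, b) \<in> bad_windows"
    proof -
      have "restrict ?z F \<in> F \<rightarrow>\<^sub>E A"
        using z F(2) by (auto simp: avoiding_iff configs_def PiE_iff)
      moreover have "\<phi> x' \<one> \<noteq> b" if "x' \<in> avoiding G A C" "\<forall>f\<in>F. x' f = restrict ?z F f" for x'
        using window[OF that(1) z] that(2) \<phi>_z by simp
      ultimately show ?thesis
        using b unfolding bad_windows_def by blast
    qed
    moreover have "place 0 (append_code (word_code e w) (word_code e (S_word f))) (d (restrict ?z F f)) \<in> I"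
      if "f \<in> F" for f
    proof -
      have f: "f \<in> carrier G"
        using that F(2) by blast
      have "word_value G (w @ S_word f) = ?g \<otimes> f"
        using w S_word[OF f] S_subset by (subst word_value_append) auto
      then have "x (?g \<otimes> f) = \<xi> 0 (word_code e (w @ S_word f))"
        using x[of "[]" "w @ S_word f"] w S_word[OF f] f g by simp
      then show ?thesis
        using that f by (intro atom) (simp add: z_eq word_code_append)
    qed
    ultimately have "clash p I"
      by (intro clash.image[OF _ wb]) blast+
    with no_clash show False ..
  qed
  then have "\<forall>(w, b)\<in>p. \<phi> x (word_value G w) = b"
    by auto
  with x_avoiding show ?thesis
    by (intro bexI[of _ x])
qed

lemma no_preimage_iff_refuted:
  assumes "p \<in> pattern_codings S B"
  shows "(\<forall>y\<in>Y. \<exists>(w, b)\<in>p. y (word_value G w) \<noteq> b) \<longleftrightarrow> (\<exists>N. \<forall>I\<subseteq>{..<N}. refuted p N I)"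
    (is "?L \<longleftrightarrow> ?R")
proof
  assume ?R
  then obtain N where N: "\<And>I. I \<subseteq> {..<N} \<Longrightarrow> refuted p N I"
    by blast
  show ?L
  proof (rule ccontr)
    assume "\<not> ?L"
    then obtain x where x: "x \<in> avoiding G A C" "\<forall>(w, b)\<in>p. \<phi> x (word_value G w) = b"
      unfolding surjective[symmetric] by auto
    show False
      by (rule notE[OF not_refuted_of_preimage[OF x(1) assms x(2)] N[OF Int_lower2]])
  qed
next
  assume L: ?L
  show ?R
  proof (rule ccontr)
    assume "\<not> ?R"
    then have "\<exists>I\<subseteq>{..<N}. \<not> refuted p N I" for N
      by blast
    then have "\<exists>I. \<forall>N. \<not> refuted p N (I \<inter> {..<N})"
      by (rule koenig_nat_sets) (rule refuted_restrict)
    then obtain I where "\<And>N. \<not> refuted p N (I \<inter> {..<N})"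
      by blast
    from preimage_of_not_refuted[OF assms this] obtain x
      where "x \<in> avoiding G A C" "\<forall>(w, b)\<in>p. \<phi> x (word_value G w) = b"
      by blast
    then show False
      using L unfolding surjective[symmetric] by fastforce
  qed
qed

section \<open>Enumerating the refutations\<close>

lemma total_rec_place:
  assumes "total_rec k U" "total_rec k W" "total_rec k F'"
  shows "total_rec k (\<lambda>xs. place (U xs) (W xs) (F' xs))"
  unfolding place_def by (intro total_rec_prod_encode assms)

text \<open>Words, letters and codings are replaced by their codes, so that every quantifier ranges over the
  numbers or over a fixed finite set.\<close>

lemma clash_iff_codes:
  assumes p: "p \<in> pattern_codings S B"
  shows "clash p I \<longleftrightarrow>
     (\<exists>u v w r. r \<in> relator_codes \<and> (\<exists>\<alpha>\<in>d ` A. \<exists>\<beta>\<in>d ` A - {\<alpha>}.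
        place (append_code u (append_code r v)) w \<alpha> \<in> I \<and> place (append_code u v) w \<beta> \<in> I)) \<or>
     (\<exists>u w. \<exists>s\<in>S. \<exists>\<alpha>\<in>d ` A. \<exists>\<beta>\<in>d ` A - {\<alpha>}.
        place u (Suc (prod_encode (e s, w))) \<alpha> \<in> I \<and>
        place (append_code u (word_code e' (T_word s))) w \<beta> \<in> I) \<or>
     (\<exists>u c. c \<in> encode_coding e d ` C \<and>
        (\<forall>n<c. n \<notin> set_decode c \<or> (\<exists>w \<alpha>. n = prod_encode (w, \<alpha>) \<and> place u w \<alpha> \<in> I))) \<or>
     (\<exists>w. \<exists>q\<in>bad_windows. prod_encode (w, d' (snd q)) \<in> coding_atoms e d' p \<and>
        (\<forall>f\<in>F. place 0 (append_code w (word_code e (S_word f))) (d (fst q f)) \<in> I))"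
    (is "_ \<longleftrightarrow> ?relator \<or> ?letter \<or> ?coding \<or> ?image")
proof
  assume "clash p I"
  then show "?relator \<or> ?letter \<or> ?coding \<or> ?image"
  proof cases
    case (relator r \<alpha> \<beta> u v w)
    then have ?relator by blast
    then show ?thesis ..
  next
    case (letter s \<alpha> \<beta> u w)
    then have ?letter by blast
    then show ?thesis by simp
  next
    case (coding c u)
    have "\<exists>w \<alpha>. n = prod_encode (w, \<alpha>) \<and> place u w \<alpha> \<in> I"
      if "n \<in> set_decode (encode_coding e d c)" for n
    proof -
      have "c \<in> pattern_codings S A"
        using coding(1) C by blast
      then have "n \<in> coding_atoms e d c"
        using that by (simp add: set_decode_encode_coding)
      then obtain w a where "(w, a) \<in> c" "n = prod_encode (word_code e w, d a)"
        by (auto simp: coding_atoms_def)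
      then show ?thesis
        using coding(2) by auto
    qed
    then have ?coding
      using coding(1) by blast
    then show ?thesis by simp
  next
    case (image \<beta> b w)
    have "prod_encode (word_code e w, d' b) \<in> coding_atoms e d' p"
      using image(2) by (auto simp: coding_atoms_def)
    with image have ?image
      by (intro exI[of _ "word_code e w"] bexI[of _ "(\<beta>, b)"]) simp_all
    then show ?thesis by simp
  qed
next
  assume "?relator \<or> ?letter \<or> ?coding \<or> ?image"
  then consider ?relator | ?letter | ?coding | ?image
    by blast
  then show "clash p I"
  proof cases
    case 1
    then obtain u v w r \<alpha> \<beta> where "r \<in> relator_codes" "\<alpha> \<in> d ` A" "\<beta> \<in> d ` A - {\<alpha>}"
      "place (append_code u (append_code r v)) w \<alpha> \<in> I" "place (append_code u v) w \<beta> \<in> I"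
      by blast
    then show ?thesis by (rule clash.relator)
  next
    case 2
    then obtain u w s \<alpha> \<beta> where "s \<in> S" "\<alpha> \<in> d ` A" "\<beta> \<in> d ` A - {\<alpha>}"
      "place u (Suc (prod_encode (e s, w))) \<alpha> \<in> I"
      "place (append_code u (word_code e' (T_word s))) w \<beta> \<in> I"
      by blast
    then show ?thesis by (rule clash.letter)
  next
    case 3
    then obtain u c where c: "c \<in> C" and all: "\<forall>n<encode_coding e d c. n \<notin> set_decode (encode_coding e d c) \<or>
        (\<exists>w \<alpha>. n = prod_encode (w, \<alpha>) \<and> place u w \<alpha> \<in> I)"
      by blast
    have "place u (word_code e w) (d a) \<in> I" if "(w, a) \<in> c" for w a
    proof -
      have "c \<in> pattern_codings S A"
        using c C by blast
      moreover have "prod_encode (word_code e w, d a) \<in> coding_atoms e d c"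
        using that by (auto simp: coding_atoms_def)
      ultimately have n: "prod_encode (word_code e w, d a) \<in> set_decode (encode_coding e d c)"
        by (simp add: set_decode_encode_coding)
      then obtain v \<alpha> where "prod_encode (word_code e w, d a) = prod_encode (v, \<alpha>)" "place u v \<alpha> \<in> I"
        using all mem_set_decode_less[OF n] by blast
      then show ?thesis
        by simp
    qed
    then show ?thesis
      by (intro clash.coding[OF c, of u]) auto
  next
    case 4
    then obtain w q where q: "q \<in> bad_windows" "prod_encode (w, d' (snd q)) \<in> coding_atoms e d' p"
      and all: "\<forall>f\<in>F. place 0 (append_code w (word_code e (S_word f))) (d (fst q f)) \<in> I"
      by blast
    obtain v b where v: "(v, b) \<in> p" "w = word_code e v" "d' (snd q) = d' b"
      using q(2) unfolding coding_atoms_def by auto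
    have "snd q \<in> B"
      using q(1) unfolding bad_windows_def by auto
    moreover have "b \<in> B"
      using v(1) p unfolding pattern_codings_def by blast
    ultimately have "snd q = b"
      using inj_onD[OF d' v(3)] by blast
    then have "(fst q, b) \<in> bad_windows"
      using q(1) by auto
    then show ?thesis
      using v(1) all unfolding v(2) by (rule clash.image)
  qed
qed

lemma sigma1_relator_codes:
  assumes "rec_enumerable (word_code e' ` R)" "total_rec k H"
  shows "sigma1 k (\<lambda>xs. H xs \<in> relator_codes)"
proof -
  have "sigma1 k (\<lambda>xs. H xs \<in> insert 0 ((\<lambda>s. word_code e' [s, inv s]) ` T) \<or> H xs \<in> word_code e' ` R)"
    by (intro sigma1_disj sigma1_decidable decidable_mem_finite sigma1_rec_enumerable assms) (simp add: finite_T)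
  then show ?thesis
    by (rule sigma1_cong) (auto simp: relator_codes_def)
qed

definition refuted_code :: "nat \<Rightarrow> nat \<Rightarrow> nat \<Rightarrow> bool" where
  "refuted_code m N t \<longleftrightarrow>
     (\<exists>u v w r. r \<in> relator_codes \<and> (\<exists>\<alpha>\<in>d ` A. \<exists>\<beta>\<in>d ` A - {\<alpha>}.
        place (append_code u (append_code r v)) w \<alpha> \<in> set_decode t \<and>
        place (append_code u v) w \<beta> \<in> set_decode t)) \<or>
     (\<exists>u w. \<exists>s\<in>S. \<exists>\<alpha>\<in>d ` A. \<exists>\<beta>\<in>d ` A - {\<alpha>}.
        place u (Suc (prod_encode (e s, w))) \<alpha> \<in> set_decode t \<and>
        place (append_code u (word_code e' (T_word s))) w \<beta> \<in> set_decode t) \<or>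
     (\<exists>u c. c \<in> encode_coding e d ` C \<and>
        (\<forall>n<c. n \<notin> set_decode c \<or>
          (\<exists>w \<alpha>. n = prod_encode (w, \<alpha>) \<and> place u w \<alpha> \<in> set_decode t))) \<or>
     (\<exists>w. \<exists>q\<in>bad_windows. prod_encode (w, d' (snd q)) \<in> set_decode m \<and>
        (\<forall>f\<in>F. place 0 (append_code w (word_code e (S_word f))) (d (fst q f)) \<in> set_decode t)) \<or>
     (\<exists>u w. \<forall>\<alpha>\<in>d ` A. place u w \<alpha> < N \<and> place u w \<alpha> \<notin> set_decode t)"

lemma refuted_iff_code:
  assumes "p \<in> pattern_codings S B"
  shows "refuted p N (set_decode t) \<longleftrightarrow> refuted_code (encode_coding e d' p) N t"
  unfolding refuted_def refuted_code_def clash_iff_codes[OF assms] set_decode_encode_coding[OF assms]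
  by blast

lemma sigma1_refuted_code:
  assumes R: "rec_enumerable (word_code e' ` R)" and C: "rec_enumerable (encode_coding e d ` C)"
    and M: "total_rec k M" and N: "total_rec k N" and t: "total_rec k t"
  shows "sigma1 k (\<lambda>xs. refuted_code (M xs) (N xs) (t xs))"
proof -
  note terms = total_rec_place total_rec_append_code total_rec_Suc total_rec_prod_encode
    total_rec_const total_rec_tl M N t total_rec_vars
  have "sigma1 k (\<lambda>xs. \<exists>u v w r. r \<in> relator_codes \<and> (\<exists>\<alpha>\<in>d ` A. \<exists>\<beta>\<in>d ` A - {\<alpha>}.
        place (append_code u (append_code r v)) w \<alpha> \<in> set_decode (t xs) \<and>
        place (append_code u v) w \<beta> \<in> set_decode (t xs)))"
    by (intro sigma1_ex sigma1_conj sigma1_relator_codes R sigma1_finite_Bex sigma1_decidable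
        decidable_mem_set_decode terms) (simp_all add: A)
  moreover have "sigma1 k (\<lambda>xs. \<exists>u w. \<exists>s\<in>S. \<exists>\<alpha>\<in>d ` A. \<exists>\<beta>\<in>d ` A - {\<alpha>}.
        place u (Suc (prod_encode (e s, w))) \<alpha> \<in> set_decode (t xs) \<and>
        place (append_code u (word_code e' (T_word s))) w \<beta> \<in> set_decode (t xs))"
    by (intro sigma1_ex sigma1_conj sigma1_finite_Bex sigma1_decidable
        decidable_mem_set_decode terms) (simp_all add: A finite_S)
  moreover have "sigma1 k (\<lambda>xs. \<exists>u c. c \<in> encode_coding e d ` C \<and>
        (\<forall>n<c. n \<notin> set_decode c \<or>
          (\<exists>w \<alpha>. n = prod_encode (w, \<alpha>) \<and> place u w \<alpha> \<in> set_decode (t xs))))"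
    by (intro sigma1_ex sigma1_conj sigma1_disj sigma1_all_less sigma1_rec_enumerable[OF C]
        sigma1_decidable decidable_not decidable_eq decidable_mem_set_decode terms) simp_all
  moreover have "sigma1 k (\<lambda>xs. \<exists>w. \<exists>q\<in>bad_windows. prod_encode (w, d' (snd q)) \<in> set_decode (M xs) \<and>
        (\<forall>f\<in>F. place 0 (append_code w (word_code e (S_word f))) (d (fst q f)) \<in> set_decode (t xs)))"
    by (intro sigma1_ex sigma1_conj sigma1_finite_Bex sigma1_finite_Ball sigma1_decidable
        decidable_mem_set_decode finite_bad_windows F(1) terms) simp_all
  moreover have "sigma1 k (\<lambda>xs. \<exists>u w. \<forall>\<alpha>\<in>d ` A. place u w \<alpha> < N xs \<and> place u w \<alpha> \<notin> set_decode (t xs))"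
    by (intro sigma1_ex sigma1_conj sigma1_finite_Ball sigma1_decidable decidable_not decidable_less
        decidable_mem_set_decode terms) (simp_all add: A)
  ultimately show ?thesis
    unfolding refuted_code_def by (intro sigma1_disj)
qed

text \<open>A number belongs to the set iff it is a well-formed code, which is decidable, and some bound \<open>N\<close>
  refutes all sets of atoms below \<open>N\<close>.\<close>

lemma rec_enumerable_forbidden_codings:
  assumes R: "rec_enumerable (word_code e' ` R)" and C: "rec_enumerable (encode_coding e d ` C)"
  shows "rec_enumerable (encode_coding e d' ` forbidden_codings G S B Y)"
proof (rule rec_enumerable_if_sigma1)
  let ?valid = "\<lambda>m. \<forall>n<m. n \<notin> set_decode m \<or> (\<exists>u b. n = prod_encode (u, b) \<and> b \<in> d' ` B \<and>
    (\<forall>i<length_code u. nth_code u i \<in> e ` S))"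
  let ?Q = "\<lambda>m. \<exists>N. \<forall>t<2 ^ N. refuted_code m N t"
  have valid: "m \<in> encode_coding e d' ` pattern_codings S B \<longleftrightarrow> ?valid m" for m
    unfolding encode_coding_range_iff[OF e d'] word_code_range_iff[symmetric]
    using mem_set_decode_less by blast
  have Q: "p \<in> forbidden_codings G S B Y \<longleftrightarrow> ?Q (encode_coding e d' p)"
    if p: "p \<in> pattern_codings S B" for p
  proof -
    have "(\<forall>I\<subseteq>{..<N}. refuted p N I) \<longleftrightarrow> (\<forall>t<2 ^ N. refuted p N (set_decode t))" for N
      using ex_subset_lessThan_iff_set_decode[of N "\<lambda>I. \<not> refuted p N I"] by blast
    then show ?thesis
      using p no_preimage_iff_refuted[OF p] unfolding forbidden_codings_def by (simp add: refuted_iff_code)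
  qed
  have "m \<in> encode_coding e d' ` forbidden_codings G S B Y \<longleftrightarrow> ?valid m \<and> ?Q m" for m
    unfolding valid[symmetric]
    by (rule encode_coding_image_iff[OF _ Q]) (auto simp: forbidden_codings_def)
  moreover have "sigma1 1 (\<lambda>xs. ?valid (hd xs) \<and> ?Q (hd xs))"
  proof (rule sigma1_conj)
    show "sigma1 1 (\<lambda>xs. ?valid (hd xs))"
      unfolding One_nat_def
      by (intro sigma1_ex sigma1_conj sigma1_disj sigma1_all_less sigma1_decidable decidable_not
          decidable_eq decidable_mem_set_decode decidable_mem_finite total_rec_prod_encode
          total_rec_nth_code total_rec_length_code total_rec_vars) (simp_all add: B finite_S)
    show "sigma1 1 (\<lambda>xs. ?Q (hd xs))"
      unfolding One_nat_def
      by (intro sigma1_ex sigma1_all_less sigma1_refuted_code R C total_rec_power_2 total_rec_vars) simp_all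
  qed
  ultimately show "sigma1 1 (\<lambda>xs. hd xs \<in> encode_coding e d' ` forbidden_codings G S B Y)"
    by simp
qed

end

theorem proposition2p7:
  fixes G :: "('a, 'm) monoid_scheme" and S :: "'a set"
    and A\<^sub>X :: "'b set" and A\<^sub>Y :: "'c set"
    and X :: "('a \<Rightarrow> 'b) set" and Y :: "('a \<Rightarrow> 'c) set"
    and \<phi> :: "('a \<Rightarrow> 'b) \<Rightarrow> ('a \<Rightarrow> 'c)"
  assumes "group G" and "recursively_presented G"
    and "symmetric_generating_set G S"
    and "finite A\<^sub>X" and "finite A\<^sub>Y"
    and "subshift G A\<^sub>X X" and "effectively_closed G S A\<^sub>X X"
    and "subshift G A\<^sub>Y Y"
    and "factor_map G A\<^sub>X X A\<^sub>Y Y \<phi>"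
  shows "effectively_closed G S A\<^sub>Y Y"
proof -
  interpret group G by fact
  obtain T R e' where pres: "presentation G T R" and e': "inj_on e' T"
    and R: "rec_enumerable (word_code e' ` R)"
    using assms(2) unfolding recursively_presented_def rec_enumerable_words_def word_code_def by blast
  obtain C e d where C: "C \<subseteq> pattern_codings S A\<^sub>X" and X: "X = avoiding G A\<^sub>X C"
    and e: "inj_on e S" and d: "inj_on d A\<^sub>X" and C_re: "rec_enumerable (encode_coding e d ` C)"
    using assms(7) unfolding effectively_closed_def rec_enumerable_codings_def by blast
  obtain d' :: "'c \<Rightarrow> nat" where d': "inj_on d' A\<^sub>Y"
    using finite_imp_inj_to_nat_seg[OF assms(5)] by blast
  have "closedin (config_topology G A\<^sub>X) X"
    using assms(6) unfolding subshift_def by blast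
  then obtain F where F: "finite F" "F \<subseteq> carrier G"
    "\<And>x z. x \<in> X \<Longrightarrow> z \<in> X \<Longrightarrow> \<forall>f\<in>F. x f = z f \<Longrightarrow> \<phi> x \<one>\<^bsub>G\<^esub> = \<phi> z \<one>\<^bsub>G\<^esub>"
    by (rule factor_map_finite_window[OF assms(4) _ assms(9)]) blast
  have shift_X: "shift G g x \<in> X" if "g \<in> carrier G" "x \<in> X" for g x
    using assms(6) that unfolding subshift_def by blast
  have equivariant: "\<phi> (shift G g x) = shift G g (\<phi> x)" if "g \<in> carrier G" "x \<in> X" for g x
    using assms(9) that unfolding factor_map_def by blast
  have "\<phi> ` X = Y"
    using assms(9) unfolding factor_map_def by blast
  then interpret coded_factor G S T R e e' A\<^sub>X d C A\<^sub>Y d' Y \<phi> F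
    using assms(3-5) pres e e' d d' C F shift_X equivariant unfolding X by unfold_locales
  have "rec_enumerable_codings S A\<^sub>Y (forbidden_codings G S A\<^sub>Y Y)"
    unfolding rec_enumerable_codings_def using e d' rec_enumerable_forbidden_codings[OF R C_re] by blast
  moreover have "forbidden_codings G S A\<^sub>Y Y \<subseteq> pattern_codings S A\<^sub>Y"
    unfolding forbidden_codings_def by blast
  moreover have "Y = avoiding G A\<^sub>Y (forbidden_codings G S A\<^sub>Y Y)"
    using avoiding_forbidden_codings[OF assms(3,8)] by (rule HOL.sym)
  ultimately show ?thesis
    unfolding effectively_closed_def by blast
qed

end
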